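(* Let $\Delta=(0,1]$, and let $\mu$ be an infinitely divisible distribution on $\mathbb Z$ with Lévy measure $\lambda G$, where $\lambda>0$ and $G$ is a probability distribution. Then the following are equivalent: (i) $\mu\in\mathcal S_\Delta\cap\mathcal D_\Delta$; (ii) $G\in\mathcal S_\Delta\cap\mathcal D_\Delta$; (iii) $G\in\mathcal L_\Delta\cap\mathcal D_\Delta$ and $\lim_{x\to\infty}\mu(x+\Delta)/G(x+\Delta)=\lambda$. If additionally $G$ is a distribution on $\mathbb Z_+$ (the non-negative integers), then the following are equivalent: (i) $\mu\in\mathcal S_\Delta$; (ii) $G\in\mathcal S_\Delta$; (iii) $G\in\mathcal L_\Delta$ and $\lim_{x\to\infty}\mu(x+\Delta)/G(x+\Delta)=\lambda$.
   Context: For $\Delta=(0,c]$ (here $c=1$) and a distribution $F$ on $\mathbb R$, $F(x+\Delta):=F((x,x+c])$. $F^{*n}$ is the $n$-fold convolution of $F$ with itself. $\alpha(x)\sim\beta(x)$ means $\alpha(x)/\beta(x)\to1$ as $x\to\infty$. An infinitely divisible distribution $\mu$ on $\mathbb R$ has characteristic function $\widehat\mu(z)=\exp\{\int_{-\infty}^\infty(e^{izy}-1-izy\mathbf 1_{\{|y|\le1\}})\nu(dy)+iaz-\frac12b^2z^2\}$ with $a\in\mathbb R$, $b\ge0$ and Lévy measure $\nu$ satisfying $\nu(\{0\})=0$, $\int(1\wedge x^2)\nu(dx)<\infty$. "On $\mathbb Z$" means concentrated on $\mathbb Z$. A non-negative measurable function $\alpha$ belongs to $\mathcal L$ if there is $x_0>0$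 with $\alpha(x)>0$ for $x\ge x_0$ and, for every fixed $y>0$, $\alpha(x+y)\sim\alpha(x)$. $F\in\mathcal L_\Delta$ if the function $x\mapsto F(x+\Delta)$ is in $\mathcal L$. $F\in\mathcal S_\Delta$ if $F\in\mathcal L_\Delta$ and $F^{*2}(x+\Delta)\sim 2F(x+\Delta)$. A function $\alpha:\mathbb R\to\mathbb R_+$ is almost decreasing if there exist $x_0>0$ and $K>0$ such that $\alpha(x+y)\le K\alpha(x)$ for all $x>x_0$, $y>0$. $F\in\mathcal D_\Delta$ if $x\mapsto F(x+\Delta)$ is almost decreasing. *)

theory Defs
  imports "HOL-Probability.Probability" "HOL-Library.Landau_Symbols"
begin

primrec conv_power :: "real measure \<Rightarrow> nat \<Rightarrow> real measure" where
  "conv_power F 0 = return borel 0"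
| "conv_power F (Suc n) = (F \<star> conv_power F n)"

definition infinitely_divisible :: "real measure \<Rightarrow> bool" where
  "infinitely_divisible \<mu> \<longleftrightarrow> real_distribution \<mu> \<and>
     (\<forall>n\<ge>1. \<exists>\<rho>. real_distribution \<rho> \<and> conv_power \<rho> n = \<mu>)"

definition levy_measure :: "real measure \<Rightarrow> bool" where
  "levy_measure \<nu> \<longleftrightarrow> sets \<nu> = sets borel \<and> emeasure \<nu> {0} = 0 \<and>
     (\<integral>\<^sup>+x. ennreal (min 1 (x\<^sup>2)) \<partial>\<nu>) < \<infinity>"

text \<open>The Levy--Khintchine representation with truncation function \<open>1\<^bsub>{|y| \<le> 1}\<^esub>\<close>. The integrand
  is bounded by a multiple of \<open>min 1 (y\<^sup>2)\<close>, so the Bochner integral is a genuine one.\<close>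

definition levy_khintchine :: "real measure \<Rightarrow> real \<Rightarrow> real \<Rightarrow> real measure \<Rightarrow> bool" where
  "levy_khintchine \<mu> a b \<nu> \<longleftrightarrow> b \<ge> 0 \<and> levy_measure \<nu> \<and>
     (\<forall>z. char \<mu> z = exp (
        (CLINT y|\<nu>. iexp (z * y) - 1 - \<i> * of_real (z * y * indicator {y. \<bar>y\<bar> \<le> 1} y))
        + \<i> * of_real (a * z) - of_real (b\<^sup>2 * z\<^sup>2 / 2)))"

definition has_levy_measure :: "real measure \<Rightarrow> real measure \<Rightarrow> bool" where
  "has_levy_measure \<mu> \<nu> \<longleftrightarrow> (\<exists>a b. levy_khintchine \<mu> a b \<nu>)"

text \<open>\<open>F(x + \<Delta>)\<close> for \<open>\<Delta> = (0, c]\<close>.\<close>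

definition local_prob :: "real \<Rightarrow> real measure \<Rightarrow> real \<Rightarrow> real" where
  "local_prob c F x = measure F {x<..x + c}"

text \<open>The library relation \<open>\<sim>[at_top]\<close> reads \<open>0 / 0\<close> as \<open>1\<close>. This plays no role below, since
  it is only used where the right-hand side is eventually positive.\<close>

definition long_tailed :: "(real \<Rightarrow> real) \<Rightarrow> bool" where
  "long_tailed \<alpha> \<longleftrightarrow> \<alpha> \<in> borel_measurable borel \<and> (\<forall>x. \<alpha> x \<ge> 0) \<and>
     (\<exists>x0>0. \<forall>x\<ge>x0. \<alpha> x > 0) \<and> (\<forall>y>0. (\<lambda>x. \<alpha> (x + y)) \<sim>[at_top] \<alpha>)"

definition almost_decreasing :: "(real \<Rightarrow> real) \<Rightarrow> bool" where
  "almost_decreasing \<alpha> \<longleftrightarrow> (\<forall>x. \<alpha> x \<ge> 0) \<and>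
     (\<exists>x0>0. \<exists>K>0. \<forall>x>x0. \<forall>y>0. \<alpha> (x + y) \<le> K * \<alpha> x)"

definition L_Delta :: "real \<Rightarrow> real measure set" where
  "L_Delta c = {F. real_distribution F \<and> long_tailed (local_prob c F)}"

definition S_Delta :: "real \<Rightarrow> real measure set" where
  "S_Delta c = {F \<in> L_Delta c.
     local_prob c (conv_power F 2) \<sim>[at_top] (\<lambda>x. 2 * local_prob c F x)}"

definition D_Delta :: "real \<Rightarrow> real measure set" where
  "D_Delta c = {F. real_distribution F \<and> almost_decreasing (local_prob c F)}"

end

theory Submission
  imports Defs
begin

text \<open>
  Everything reduces to sequences on \<open>\<int>\<close>. At \<open>z = 2 * pi\<close> the characteristic function of a
  lattice law is \<open>1\<close>; read through the Levy-Khintchine formula this forces the Gaussian part to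
  vanish, \<open>G\<close> to live on \<open>\<int>\<close> and the drift to be an integer \<open>m\<close>
  (\<open>lattice_compound_poisson\<close>). So the mass function of \<open>\<mu>\<close> is the translate by \<open>m\<close> of the compound
  Poisson sequence \<open>p = exp (- lam) * exp (lam * g)\<close>, the exponential being taken in the convolution
  algebra \<open>\<ell>\<^sup>1(\<int>)\<close> and \<open>g\<close> being the mass function of \<open>G\<close>. Since \<open>F(x + \<Delta>)\<close> is the mass of a single
  integer, the classes on the line become conditions on \<open>p\<close> and \<open>g\<close>, and these conditions do not see
  the translation.

  Fix a probability sequence \<open>w\<close> that is subexponential: \<open>w (n + 1) / w n \<rightarrow> 1\<close> and
  \<open>(w * w) n / w n \<rightarrow> 2\<close>, with convolution as product. Call \<open>a\<close> the ratio limit of a summable \<open>f\<close>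
  if \<open>f n / w n \<rightarrow> a\<close>. The sequences with a ratio limit form an algebra, because in a convolution
  only one factor can be far out: if \<open>f\<close> and \<open>h\<close> have ratio limits \<open>a\<close> and \<open>b\<close>, then \<open>f * h\<close> has ratio
  limit \<open>a * \<Sum>h + b * \<Sum>f\<close> (\<open>ratio_lim_conv\<close>). Kesten's bound \<open>\<bar>f\<^sup>k n\<bar> \<le> C * r\<^sup>k * w n\<close> for large \<open>n\<close> and
  all \<open>k\<close>, valid for every \<open>r\<close> above the \<open>\<ell>\<^sup>1\<close> norm of \<open>f\<close>
  (\<open>seq_pow_bound\<close>), then admits power series: the ratio limit of \<open>\<Sum>\<^sub>k c\<^sub>k f\<^sup>k\<close> is
  \<open>a * \<Sum>\<^sub>k k * c\<^sub>k * s\<^sup>k\<^sup>-\<^sup>1\<close> with \<open>s = \<Sum>f\<close> (\<open>ratio_lim_power_series\<close>). Terms of \<open>f\<close> at negative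
  indices shift the argument of the other factor to the right; they are harmless when \<open>w\<close> is almost
  decreasing and absent when all sequences live on the non-negative integers. These are the two
  halves of the theorem, and they are treated together.

  From \<open>G\<close> to \<open>\<mu>\<close>, take \<open>w = g\<close> and the exponential series: \<open>p\<close> has ratio limit \<open>lam\<close>, and it is
  subexponential, like every sequence of sum \<open>1\<close> with a positive ratio limit
  (\<open>compound_poisson_of_seq_S\<close>).

  From the limit of \<open>p n / g n\<close> to \<open>G\<close>, long-tailedness alone gives
  \<open>liminf g\<^sup>k n / g n \<ge> k\<close>. The sum of these quotients with Poisson weights
  converges to \<open>lam\<close>, which is also the weighted sum of the lower bounds, so none of the quotients can
  exceed its bound in the limit; \<open>k = 2\<close> is the claim
  (\<open>seq_S_of_compound_poisson_ratio\<close>).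

  From \<open>\<mu>\<close> to \<open>G\<close>, take \<open>w = p\<close> and recover \<open>lam * g\<close> as a logarithm. The logarithmic series
  converges only near the unit of the algebra, so \<open>lam * g\<close> is first split into a part \<open>- f1\<close> of finite
  support and a part \<open>f2\<close> of small norm. The sequence \<open>f1\<close> has ratio limit \<open>0\<close>, hence
  \<open>exp f2 = exp lam * exp f1 * p\<close> has a ratio limit; it is close to the unit, and the logarithmic series
  returns \<open>f2\<close> with ratio limit \<open>1\<close>. Hence \<open>g\<close> has ratio limit \<open>1 / lam\<close>
  (\<open>seq_S_of_compound_poisson\<close>). Identities between convolution exponentials and logarithms are read
  off from Fourier transforms, which determine a summable sequence (\<open>fourier_inject\<close>).
\<close>

section \<open>The convolution algebra of summable sequences on the integers\<close>

text \<open>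
  The shear \<open>(n, j) \<mapsto> (j, n - j)\<close> turns the convolution into a double sum over a product.
  Real sequences are needed for convolution itself, complex ones for Fourier transforms.
\<close>
lemma
  fixes a b :: "int \<Rightarrow> 'a::{real_normed_field,banach}"
  assumes a: "(\<lambda>x. norm (a x)) summable_on UNIV" and b: "(\<lambda>x. norm (b x)) summable_on UNIV"
  shows cauchy_product_int_summable: "(\<lambda>j. norm (a j * b (n - j))) summable_on UNIV"
    and cauchy_product_int_abs_summable: "(\<lambda>n. norm (\<Sum>\<^sub>\<infinity>j. a j * b (n - j))) summable_on UNIV"
    and cauchy_product_int_infsum:
      "(\<Sum>\<^sub>\<infinity>n. \<Sum>\<^sub>\<infinity>j. a j * b (n - j)) = infsum a UNIV * infsum b UNIV"
proof -
  have P: "(\<lambda>x. norm (case x of (j,k) \<Rightarrow> a j * b k)) summable_on (UNIV \<times> UNIV)"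
    by (subst Infinite_Sum.abs_summable_on_Sigma_iff)
       (auto simp: norm_mult infsum_cmult_right' a b abs_mult infsum_nonneg
        intro!: summable_on_cmult_right summable_on_cmult_left)
  have bij: "bij_betw (\<lambda>(n,j). (j, n - j)) (UNIV :: (int \<times> int) set) (UNIV \<times> UNIV)"
    by (rule bij_betwI[where g = "\<lambda>(j,k). (j + k, j)"]) auto
  have Q: "(\<lambda>x. norm (case x of (n,j) \<Rightarrow> a j * b (n - j))) summable_on (UNIV \<times> UNIV)"
    using summable_on_reindex_bij_betw[OF bij, of "\<lambda>x. norm ((\<lambda>(j,k). a j * b k) x)"] P
    by (simp add: case_prod_unfold)
  show inner: "(\<lambda>j. norm (a j * b (n - j))) summable_on UNIV" for n
    using Q unfolding Infinite_Sum.abs_summable_on_Sigma_iff by auto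
  have "(\<lambda>n. \<Sum>\<^sub>\<infinity>j. norm (a j * b (n - j))) summable_on UNIV"
    using Q unfolding Infinite_Sum.abs_summable_on_Sigma_iff by (auto simp: infsum_nonneg)
  then show "(\<lambda>n. norm (\<Sum>\<^sub>\<infinity>j. a j * b (n - j))) summable_on UNIV"
  proof (rule Infinite_Sum.abs_summable_on_comparison_test')
    show "norm (\<Sum>\<^sub>\<infinity>j. a j * b (n - j)) \<le> (\<Sum>\<^sub>\<infinity>j. norm (a j * b (n - j)))" for n
      by (rule norm_infsum_bound[OF inner])
  qed
  have "(\<Sum>\<^sub>\<infinity>n. \<Sum>\<^sub>\<infinity>j. a j * b (n - j)) = infsum (\<lambda>(n,j). a j * b (n - j)) (UNIV \<times> UNIV)"
    by (rule infsum_Sigma'_banach) (rule abs_summable_summable[OF Q])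
  also have "\<dots> = infsum (\<lambda>(j,k). a j * b k) (UNIV \<times> UNIV)"
    using infsum_reindex_bij_betw[OF bij, of "\<lambda>(j,k). a j * b k"]
    by (simp add: case_prod_unfold)
  also have "\<dots> = (\<Sum>\<^sub>\<infinity>j. \<Sum>\<^sub>\<infinity>k. a j * b k)"
    by (rule infsum_Sigma'_banach[symmetric]) (rule abs_summable_summable[OF P])
  also have "\<dots> = infsum a UNIV * infsum b UNIV"
    by (simp add: infsum_cmult_right' infsum_cmult_left')
  finally show "(\<Sum>\<^sub>\<infinity>n. \<Sum>\<^sub>\<infinity>j. a j * b (n - j)) = infsum a UNIV * infsum b UNIV" .
qed

lemma summable_on_abs_iff:
  fixes f :: "'a \<Rightarrow> real"
  shows "(\<lambda>x. \<bar>f x\<bar>) summable_on A \<longleftrightarrow> f summable_on A"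
  using summable_on_iff_abs_summable_on_real[of f A] by simp

lemma infsum_of_real:
  "f summable_on A \<Longrightarrow>
    (\<Sum>\<^sub>\<infinity>x\<in>A. of_real (f x) :: 'a :: real_normed_algebra_1) = of_real (infsum f A)"
  by (rule infsumI) (rule has_sum_of_real, simp)

definition conv :: "(int \<Rightarrow> real) \<Rightarrow> (int \<Rightarrow> real) \<Rightarrow> int \<Rightarrow> real" where
  "conv f g n = (\<Sum>\<^sub>\<infinity>j. f j * g (n - j))"

definition unit_seq :: "int \<Rightarrow> real" where
  "unit_seq n = (if n = 0 then 1 else 0)"

primrec seq_pow :: "(int \<Rightarrow> real) \<Rightarrow> nat \<Rightarrow> int \<Rightarrow> real" where
  "seq_pow f 0 = unit_seq"
| "seq_pow f (Suc k) = conv f (seq_pow f k)"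

definition l1 :: "(int \<Rightarrow> real) \<Rightarrow> real" where
  "l1 f = (\<Sum>\<^sub>\<infinity>n. \<bar>f n\<bar>)"

text \<open>
  This is the characteristic function of the sequence, extended to signed masses.
\<close>
definition fourier :: "(int \<Rightarrow> real) \<Rightarrow> real \<Rightarrow> complex" where
  "fourier f t = (\<Sum>\<^sub>\<infinity>n. of_real (f n) * cis (t * of_int n))"

abbreviation ell1 :: "(int \<Rightarrow> real) \<Rightarrow> bool" where
  "ell1 f \<equiv> f summable_on UNIV"

lemma l1_nonneg [simp]: "l1 f \<ge> 0"
  by (simp add: l1_def infsum_nonneg)

lemma abs_le_l1: "ell1 f \<Longrightarrow> \<bar>f n\<bar> \<le> l1 f"
  using finite_sum_le_infsum[of "\<lambda>n. \<bar>f n\<bar>" UNIV "{n}"]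
  by (simp add: l1_def summable_on_abs_iff)

lemma abs_infsum_le_l1:
  assumes "ell1 f"
  shows "\<bar>infsum f UNIV\<bar> \<le> l1 f"
  using norm_infsum_bound[of f UNIV] assms by (simp add: l1_def summable_on_abs_iff)

lemma conv_summable: "ell1 f \<Longrightarrow> ell1 g \<Longrightarrow> (\<lambda>j. f j * g (n - j)) summable_on UNIV"
  using cauchy_product_int_summable[of f g n]
  by (simp add: summable_on_abs_iff)

lemma ell1_conv: "ell1 f \<Longrightarrow> ell1 g \<Longrightarrow> ell1 (conv f g)"
  using cauchy_product_int_abs_summable[of f g]
  by (simp add: summable_on_abs_iff conv_def[abs_def])

lemma infsum_conv:
  "ell1 f \<Longrightarrow> ell1 g \<Longrightarrow> infsum (conv f g) UNIV = infsum f UNIV * infsum g UNIV"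
  using cauchy_product_int_infsum[of f g]
  by (simp add: summable_on_abs_iff conv_def[abs_def])

lemma l1_conv_le:
  assumes f: "ell1 f" and g: "ell1 g"
  shows "l1 (conv f g) \<le> l1 f * l1 g"
proof -
  have F: "ell1 (\<lambda>n. \<bar>f n\<bar>)" and G: "ell1 (\<lambda>n. \<bar>g n\<bar>)"
    using f g by (simp_all add: summable_on_abs_iff)
  have "l1 (conv f g) \<le> infsum (conv (\<lambda>n. \<bar>f n\<bar>) (\<lambda>n. \<bar>g n\<bar>)) UNIV"
    unfolding l1_def
  proof (rule infsum_mono)
    show "(\<lambda>n. \<bar>conv f g n\<bar>) summable_on UNIV"
      using ell1_conv[OF f g] by (simp add: summable_on_abs_iff)
    show "\<bar>conv f g n\<bar> \<le> conv (\<lambda>n. \<bar>f n\<bar>) (\<lambda>n. \<bar>g n\<bar>) n" for n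
      using norm_infsum_bound[of "\<lambda>j. f j * g (n - j)" UNIV] conv_summable[OF f g, of n]
      by (simp add: conv_def summable_on_abs_iff flip: abs_mult)
  qed (rule ell1_conv[OF F G])
  also have "\<dots> = l1 f * l1 g"
    by (simp add: infsum_conv[OF F G] l1_def)
  finally show ?thesis .
qed

lemma unit_seq_has_sum: "(unit_seq has_sum 1) UNIV"
proof -
  have "(unit_seq has_sum 1) {0}"
    by (rule has_sum_finiteI) (auto simp: unit_seq_def)
  then show ?thesis
    by (subst has_sum_cong_neutral[where T = "{0}" and g = unit_seq]) (auto simp: unit_seq_def)
qed

lemma ell1_unit [simp]: "ell1 unit_seq" and infsum_unit [simp]: "infsum unit_seq UNIV = 1"
  and l1_unit [simp]: "l1 unit_seq = 1"
proof -
  show "ell1 unit_seq" "infsum unit_seq UNIV = 1"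
    using unit_seq_has_sum by (auto simp: has_sum_iff)
  then show "l1 unit_seq = 1"
    using infsum_cong[of UNIV "\<lambda>n. \<bar>unit_seq n\<bar>" unit_seq]
    by (simp add: l1_def unit_seq_def)
qed

lemma ell1_seq_pow: "ell1 f \<Longrightarrow> ell1 (seq_pow f k)"
  by (induction k) (auto intro: ell1_conv)

lemma infsum_seq_pow: "ell1 f \<Longrightarrow> infsum (seq_pow f k) UNIV = infsum f UNIV ^ k"
  by (induction k) (auto simp: infsum_conv ell1_seq_pow)

lemma l1_seq_pow_le: "ell1 f \<Longrightarrow> l1 (seq_pow f k) \<le> l1 f ^ k"
proof (induction k)
  case (Suc k)
  have "l1 (seq_pow f (Suc k)) \<le> l1 f * l1 (seq_pow f k)"
    using Suc by (simp add: l1_conv_le ell1_seq_pow)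
  also have "\<dots> \<le> l1 f * l1 f ^ k"
    using Suc by (intro mult_left_mono) auto
  finally show ?case by simp
qed auto

lemma abs_seq_pow_le: "ell1 f \<Longrightarrow> \<bar>seq_pow f k n\<bar> \<le> l1 f ^ k"
  by (rule order_trans[OF abs_le_l1 l1_seq_pow_le]) (auto intro: ell1_seq_pow)

lemma fourier_abs_summable:
  "ell1 f \<Longrightarrow> (\<lambda>n. norm (of_real (f n) * cis (t * of_int n))) summable_on UNIV"
  by (simp add: norm_mult summable_on_abs_iff)

lemma fourier_conv:
  assumes "ell1 f" "ell1 g"
  shows "fourier (conv f g) t = fourier f t * fourier g t"
proof -
  have "of_real (conv f g n) * cis (t * of_int n) =
    (\<Sum>\<^sub>\<infinity>j. (of_real (f j) * cis (t * of_int j)) * (of_real (g (n - j)) * cis (t * of_int (n - j))))" for n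
  proof -
    have "of_real (conv f g n) = (\<Sum>\<^sub>\<infinity>j. complex_of_real (f j * g (n - j)))"
      unfolding conv_def by (rule infsum_of_real[symmetric]) (rule conv_summable[OF assms])
    also have "\<dots> * cis (t * of_int n) =
      (\<Sum>\<^sub>\<infinity>j. complex_of_real (f j * g (n - j)) * cis (t * of_int n))"
      by (rule infsum_cmult_left'[symmetric])
    also have "\<dots> = (\<Sum>\<^sub>\<infinity>j. (of_real (f j) * cis (t * of_int j)) *
        (of_real (g (n - j)) * cis (t * of_int (n - j))))"
    proof (rule infsum_cong)
      fix j :: int
      have c: "cis (t * of_int n) = cis (t * of_int j) * cis (t * of_int (n - j))"
        by (simp add: cis_mult algebra_simps)
      show "complex_of_real (f j * g (n - j)) * cis (t * of_int n) =
        (of_real (f j) * cis (t * of_int j)) * (of_real (g (n - j)) * cis (t * of_int (n - j)))"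
        unfolding c by (simp only: of_real_mult mult_ac)
    qed
    finally show ?thesis .
  qed
  then show ?thesis
    using cauchy_product_int_infsum[OF fourier_abs_summable[OF assms(1)] fourier_abs_summable[OF assms(2)]]
    by (simp add: fourier_def)
qed

lemma fourier_unit: "fourier unit_seq t = 1"
proof -
  have "fourier unit_seq t = (\<Sum>\<^sub>\<infinity>n\<in>{0}. of_real (unit_seq n) * cis (t * of_int n))"
    unfolding fourier_def by (rule infsum_cong_neutral) (auto simp: unit_seq_def)
  then show ?thesis by (simp add: unit_seq_def)
qed

lemma fourier_seq_pow: "ell1 f \<Longrightarrow> fourier (seq_pow f k) t = fourier f t ^ k"
  by (induction k) (auto simp: fourier_conv fourier_unit ell1_seq_pow)

lemma fourier_0: "ell1 f \<Longrightarrow> fourier f 0 = of_real (infsum f UNIV)"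
  by (simp add: fourier_def infsum_of_real)

lemma norm_fourier_le:
  assumes "ell1 f"
  shows "norm (fourier f t) \<le> l1 f"
  using norm_infsum_bound[OF fourier_abs_summable[OF assms]]
  by (simp add: fourier_def l1_def norm_mult)

lemma fourier_add: "ell1 f \<Longrightarrow> ell1 g \<Longrightarrow> fourier (\<lambda>n. f n + g n) t = fourier f t + fourier g t"
  unfolding fourier_def
  by (subst infsum_add[symmetric])
     (auto simp: algebra_simps intro!: abs_summable_summable fourier_abs_summable)

lemma fourier_cmult: "fourier (\<lambda>n. c * f n) t = of_real c * fourier f t"
  unfolding fourier_def by (simp add: mult.assoc infsum_cmult_right')

lemma fourier_shift: "fourier (\<lambda>n. f (n - m)) t = cis (t * of_int m) * fourier f t"
proof -
  have b: "bij_betw (\<lambda>j. j - m) UNIV (UNIV :: int set)"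
    by (rule bij_betwI[where g = "\<lambda>j. j + m"]) auto
  have "fourier (\<lambda>n. f (n - m)) t =
    (\<Sum>\<^sub>\<infinity>n. cis (t * of_int m) * (of_real (f (n - m)) * cis (t * of_int (n - m))))"
    unfolding fourier_def
  proof (rule infsum_cong)
    fix n :: int
    have c: "cis (t * of_int n) = cis (t * of_int m) * cis (t * of_int (n - m))"
      by (simp add: cis_mult algebra_simps)
    show "of_real (f (n - m)) * cis (t * of_int n) =
      cis (t * of_int m) * (of_real (f (n - m)) * cis (t * of_int (n - m)))"
      unfolding c by (simp only: mult_ac)
  qed
  then show ?thesis
    using infsum_reindex_bij_betw[OF b, of "\<lambda>n. of_real (f n) * cis (t * of_int n)"]
    by (simp add: infsum_cmult_right' fourier_def)
qed

text \<open>
  A power series evaluated at an element of the convolution algebra.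
\<close>
definition power_series :: "(nat \<Rightarrow> real) \<Rightarrow> (int \<Rightarrow> real) \<Rightarrow> int \<Rightarrow> real" where
  "power_series c f n = (\<Sum>k. c k * seq_pow f k n)"

lemma power_series_summable:
  assumes "ell1 f" and "summable (\<lambda>k. \<bar>c k\<bar> * l1 f ^ k)"
  shows "summable (\<lambda>k. \<bar>c k * seq_pow f k n\<bar>)" and "summable (\<lambda>k. c k * seq_pow f k n)"
proof -
  show 1: "summable (\<lambda>k. \<bar>c k * seq_pow f k n\<bar>)"
    by (rule summable_comparison_test'[OF assms(2), of 0])
       (auto simp: abs_mult intro!: mult_left_mono abs_seq_pow_le assms)
  from summable_rabs_cancel[OF 1] show "summable (\<lambda>k. c k * seq_pow f k n)" .
qed

lemma infsum_eq_suminf: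
  fixes f :: "nat \<Rightarrow> 'a::banach"
  assumes "summable (\<lambda>n. norm (f n))"
  shows "infsum f UNIV = suminf f"
  by (rule infsumI[OF norm_summable_imp_has_sum[OF assms summable_sums[OF summable_norm_cancel[OF assms]]]])

text \<open>
  Absolute convergence of the double series over exponents and integers; the
  sum of absolute values over the integers is at most \<open>\<bar>c\<^sub>k\<bar>\<close> times the \<open>k\<close>-th power of the norm.
\<close>
lemma
  assumes f: "ell1 f" and c: "summable (\<lambda>k. \<bar>c k\<bar> * l1 f ^ k)"
  shows ell1_power_series: "ell1 (power_series c f)"
    and fourier_power_series: "fourier (power_series c f) t = (\<Sum>k. of_real (c k) * fourier f t ^ k)"
proof -
  have absc: "(\<lambda>k. \<bar>c k\<bar> * l1 f ^ k) summable_on UNIV"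
    by (rule norm_summable_imp_summable_on) (use c in simp)
  define a where "a t n k = of_real (c k * seq_pow f k n) * cis (t * of_int n)" for t n and k :: nat
  have norm_a: "norm (a t n k) = \<bar>c k\<bar> * \<bar>seq_pow f k n\<bar>" for t n k
    by (simp add: a_def norm_mult abs_mult)
  have inner: "(\<lambda>n. norm (a t n k)) summable_on UNIV" for t k
    unfolding norm_a
    by (intro summable_on_cmult_right) (simp add: summable_on_abs_iff ell1_seq_pow f)
  have inner_sum: "infsum (\<lambda>n. norm (a t n k)) UNIV \<le> \<bar>c k\<bar> * l1 f ^ k" for t k
    unfolding norm_a infsum_cmult_right'
    using l1_seq_pow_le[OF f, of k] by (simp add: l1_def mult_left_mono)
  have S: "(\<lambda>x. norm (case x of (k,n) \<Rightarrow> a t n k)) summable_on (UNIV \<times> UNIV)" for t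
    unfolding Infinite_Sum.abs_summable_on_Sigma_iff
  proof (intro conjI ballI)
    show "(\<lambda>k. norm (infsum (\<lambda>n. norm (case (k, n) of (k, n) \<Rightarrow> a t n k)) UNIV)) summable_on UNIV"
      by (rule Infinite_Sum.abs_summable_on_comparison_test'[OF absc])
         (use inner_sum in \<open>auto simp: infsum_nonneg\<close>)
  qed (use inner in auto)
  have sera: "of_real (power_series c f n) * cis (t * of_int n) = (\<Sum>\<^sub>\<infinity>k. a t n k)" for t n
  proof -
    have "power_series c f n = (\<Sum>\<^sub>\<infinity>k. c k * seq_pow f k n)"
      unfolding power_series_def using power_series_summable(1)[OF f c, of n]
      by (subst infsum_eq_suminf) auto
    moreover have "(\<lambda>k. c k * seq_pow f k n) summable_on UNIV"
      by (rule norm_summable_imp_summable_on) (use power_series_summable(1)[OF f c, of n] in simp)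
    ultimately show ?thesis
      by (simp only: a_def infsum_cmult_left' infsum_of_real)
  qed
  have S': "(\<lambda>(n,k). a t n k) summable_on (UNIV \<times> UNIV)" for t
    using abs_summable_summable[OF S, of t] by (subst summable_on_swap) (simp add: case_prod_unfold)
  show "ell1 (power_series c f)"
    using summable_on_Re[OF summable_on_Sigma_banach[OF S', of 0, folded sera]] by simp
  have fourier_eq: "fourier (power_series c f) t = (\<Sum>\<^sub>\<infinity>k. of_real (c k) * fourier f t ^ k)" for t
  proof -
    have "fourier (power_series c f) t = (\<Sum>\<^sub>\<infinity>n. \<Sum>\<^sub>\<infinity>k. a t n k)"
      by (simp add: fourier_def sera)
    also have "\<dots> = (\<Sum>\<^sub>\<infinity>k. \<Sum>\<^sub>\<infinity>n. a t n k)"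
      by (rule infsum_swap_banach[OF S'])
    also have "\<dots> = (\<Sum>\<^sub>\<infinity>k. of_real (c k) * fourier f t ^ k)"
    proof (rule infsum_cong)
      show "(\<Sum>\<^sub>\<infinity>n. a t n k) = of_real (c k) * fourier f t ^ k" for k
        using fourier_seq_pow[OF f, of k t] by (simp add: a_def mult.assoc infsum_cmult_right' fourier_def)
    qed
    finally show ?thesis .
  qed
  show "fourier (power_series c f) t = (\<Sum>k. of_real (c k) * fourier f t ^ k)"
    unfolding fourier_eq
  proof (rule infsum_eq_suminf, rule summable_comparison_test'[OF c, of 0])
    show "norm (norm (of_real (c k) * fourier f t ^ k)) \<le> \<bar>c k\<bar> * l1 f ^ k" for k
      by (simp add: norm_mult norm_power mult_left_mono power_mono norm_fourier_le f)
  qed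
qed

section \<open>Lattice distributions and injectivity of the Fourier transform\<close>
lemma lattice_integral:
  fixes h :: "int \<Rightarrow> complex" and f :: "int \<Rightarrow> real"
  assumes f: "\<And>n. f n \<ge> 0" "ell1 f" and h: "\<And>n. norm (h n) \<le> 1"
  shows "(CLINT n|density (count_space UNIV) (\<lambda>n. ennreal (f n)). h n) = (\<Sum>\<^sub>\<infinity>n. of_real (f n) * h n)"
proof -
  have "(CLINT n|density (count_space UNIV) (\<lambda>n. ennreal (f n)). h n) =
    (CLINT n|count_space UNIV. f n *\<^sub>R h n)"
    by (rule integral_density) (auto simp: f)
  also have "\<dots> = infsetsum (\<lambda>n. of_real (f n) * h n) UNIV"
    by (simp add: infsetsum_def scaleR_conv_of_real)
  also have "\<dots> = (\<Sum>\<^sub>\<infinity>n. of_real (f n) * h n)"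
  proof (rule infsetsum_infsum)
    have "(\<lambda>n. norm (of_real (f n) * h n)) summable_on UNIV"
    proof (rule Infinite_Sum.abs_summable_on_comparison_test'[OF f(2)])
      show "norm (of_real (f n) * h n) \<le> f n" for n
        using mult_left_mono[OF h[of n] f(1)[of n]] f(1)[of n] by (simp add: norm_mult)
    qed
    then show "Infinite_Set_Sum.abs_summable_on (\<lambda>n. of_real (f n) * h n) UNIV"
      by (simp add: abs_summable_equivalent)
  qed
  finally show ?thesis .
qed

definition mass :: "real measure \<Rightarrow> int \<Rightarrow> real" where
  "mass F n = measure F {of_int n}"

lemma mass_nonneg [simp]: "mass F n \<ge> 0"
  by (simp add: mass_def)

text \<open>
  The floor function transports the measure to the discrete space \<open>\<int>\<close>, where measures are
  determined by their point masses.
\<close>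
lemma lattice_distr_floor:
  assumes F: "real_distribution F"
  shows "distr F (count_space UNIV) floor =
    density (count_space UNIV) (\<lambda>n. ennreal (measure F {of_int n..<of_int n + 1}))"
proof -
  interpret real_distribution F by fact
  show ?thesis
  proof (rule measure_eqI_countable[of _ UNIV])
    fix n :: int
    have "floor -` {n} = {real_of_int n..<of_int n + 1}"
      by (auto simp: floor_eq_iff)
    then show "emeasure (distr F (count_space UNIV) floor) {n} =
      emeasure (density (count_space UNIV) (\<lambda>n. ennreal (measure F {of_int n..<of_int n + 1}))) {n}"
      by (simp add: emeasure_distr emeasure_density nn_integral_count_space_indicator
          emeasure_eq_measure flip: indicator_eq_0_iff)
  qed auto
qed

lemma lattice_mass:
  assumes F: "real_distribution F" and Z: "AE x in F. x \<in> \<int>"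
  shows "measure F {of_int n..<of_int n + 1} = mass F n"
proof -
  interpret real_distribution F by fact
  show ?thesis
    unfolding mass_def
  proof (rule measure_eq_AE)
    show "AE x in F. x \<in> {of_int n..<of_int n + 1} \<longleftrightarrow> x \<in> {real_of_int n}"
      using Z by eventually_elim (auto elim!: Ints_cases)
  qed auto
qed

lemma lattice_distr_mass:
  assumes F: "real_distribution F" and Z: "AE x in F. x \<in> \<int>"
  shows "distr F (count_space UNIV) floor = density (count_space UNIV) (\<lambda>n. ennreal (mass F n))"
  using lattice_distr_floor[OF F] by (simp add: lattice_mass[OF F Z])

lemma
  assumes F: "real_distribution F" and Z: "AE x in F. x \<in> \<int>"
  shows ell1_mass: "ell1 (mass F)" and infsum_mass: "infsum (mass F) UNIV = 1"
proof -
  interpret real_distribution F by fact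
  have P: "prob_space (distr F (count_space UNIV) (floor :: real \<Rightarrow> int))"
    by (rule prob_space_distr) simp
  have "(\<integral>\<^sup>+n. ennreal (mass F n) \<partial>count_space UNIV) = 1"
    using prob_space.emeasure_space_1[OF P]
    by (simp add: lattice_distr_mass[OF F Z] emeasure_density)
  then have *: "Infinite_Set_Sum.abs_summable_on (mass F) UNIV" "infsetsum (mass F) UNIV = 1"
    by (auto simp: abs_summable_on_def integrable_iff_bounded infsetsum_def integral_eq_nn_integral)
  then show "ell1 (mass F)"
    using abs_summable_equivalent[of "mass F" UNIV] by (simp add: summable_on_abs_iff)
  show "infsum (mass F) UNIV = 1"
    using infsetsum_infsum[OF *(1)] *(2) by simp
qed

lemma lattice_char:
  assumes F: "real_distribution F" and Z: "AE x in F. x \<in> \<int>"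
  shows "char F t = fourier (mass F) t"
proof -
  interpret real_distribution F by fact
  have "char F t = (CLINT x|F. iexp (t * of_int \<lfloor>x\<rfloor>))"
    unfolding char_def
    by (rule integral_cong_AE) (use Z in \<open>auto elim!: Ints_cases\<close>)
  also have "\<dots> = (CLINT n|distr F (count_space UNIV) floor. iexp (t * of_int n))"
    by (rule integral_distr[symmetric]) auto
  also have "\<dots> = fourier (mass F) t"
    unfolding lattice_distr_mass[OF F Z] fourier_def
    by (subst lattice_integral) (auto simp: ell1_mass[OF F Z] cis_conv_exp)
  finally show ?thesis .
qed

lemma lattice_measure_exists:
  assumes f: "\<And>n. f n \<ge> 0" "ell1 f" "infsum f UNIV = 1"
  obtains F where "real_distribution F" "AE x in F. x \<in> \<int>" "mass F = f"
proof -
  let ?D = "density (count_space UNIV) (\<lambda>n. ennreal (f n))"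
  have s: "Infinite_Set_Sum.abs_summable_on f UNIV"
    using f(2) abs_summable_equivalent[of f UNIV] by (simp add: summable_on_abs_iff)
  have "(\<integral>\<^sup>+n. ennreal (f n) \<partial>count_space UNIV) = ennreal (infsetsum f UNIV)"
    by (rule nn_integral_conv_infsetsum[OF s]) (simp add: f)
  also have "\<dots> = 1"
    using infsetsum_infsum[OF s] f by simp
  finally have 1: "(\<integral>\<^sup>+n. ennreal (f n) \<partial>count_space UNIV) = 1" .
  have "prob_space ?D"
    by (rule prob_spaceI) (simp add: emeasure_density 1)
  then interpret D: prob_space ?D .
  show ?thesis
  proof (rule that[of "distr ?D borel real_of_int"])
    show "real_distribution (distr ?D borel real_of_int)"
      by (rule D.real_distribution_distr) simp
    show "AE x in distr ?D borel real_of_int. x \<in> \<int>"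
      by (subst AE_distr_iff) auto
    show "mass (distr ?D borel real_of_int) = f"
    proof
      fix n
      have "real_of_int -` {of_int n} = {n}" by auto
      then show "mass (distr ?D borel real_of_int) n = f n"
        by (simp add: mass_def measure_def emeasure_distr emeasure_density
            nn_integral_count_space_indicator f)
    qed
  qed
qed

text \<open>
  At frequency \<open>0\<close> the transform is the total sum, so both sequences can be normalised by the same
  constant to lattice distributions, and Levy's uniqueness theorem applies.
\<close>
lemma fourier_inject_nonneg:
  assumes f: "\<And>n. f n \<ge> 0" "ell1 f" and g: "\<And>n. g n \<ge> 0" "ell1 g"
    and eq: "\<And>t. fourier f t = fourier g t"
  shows "f = g"
proof -
  define s where "s = infsum f UNIV"
  have sg: "infsum g UNIV = s"
    using eq[of 0] by (simp add: fourier_0 f g s_def)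
  have s: "s \<ge> 0" by (simp add: s_def infsum_nonneg f)
  show ?thesis
  proof (cases "s = 0")
    case True
    have "f n = 0" "g n = 0" for n
      using nonneg_infsum_le_0D[of f UNIV n] nonneg_infsum_le_0D[of g UNIV n] f g sg True s_def by auto
    then show ?thesis by auto
  next
    case False
    then have s: "s > 0" using s by simp
    obtain F where F: "real_distribution F" "AE x in F. x \<in> \<int>" "mass F = (\<lambda>n. inverse s * f n)"
      using lattice_measure_exists[of "\<lambda>n. inverse s * f n"] f s
      by (auto simp: infsum_cmult_right' s_def[symmetric] intro!: summable_on_cmult_right)
    obtain G where G: "real_distribution G" "AE x in G. x \<in> \<int>" "mass G = (\<lambda>n. inverse s * g n)"
      using lattice_measure_exists[of "\<lambda>n. inverse s * g n"] g s sg
      by (auto simp: infsum_cmult_right' intro!: summable_on_cmult_right)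
    have "char F = char G"
      by (simp add: fun_eq_iff lattice_char F G fourier_cmult eq)
    then have "F = G" by (rule Levy_uniqueness[OF F(1) G(1)])
    then have "(\<lambda>n. inverse s * f n) = (\<lambda>n. inverse s * g n)" using F(3) G(3) by simp
    then show ?thesis using s by (simp add: fun_eq_iff)
  qed
qed

text \<open>
  Adding \<open>\<bar>f\<bar> + \<bar>g\<bar>\<close> to both sides reduces signed sequences to non-negative ones.
\<close>
lemma fourier_inject:
  assumes f: "ell1 f" and g: "ell1 g" and eq: "\<And>t. fourier f t = fourier g t"
  shows "f = g"
proof -
  define a where "a n = \<bar>f n\<bar> + \<bar>g n\<bar>" for n
  have a: "ell1 a" unfolding a_def
    by (intro summable_on_add) (simp_all add: summable_on_abs_iff f g)
  have "(\<lambda>n. f n + a n) = (\<lambda>n. g n + a n)"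
  proof (rule fourier_inject_nonneg)
    show "f n + a n \<ge> 0" "g n + a n \<ge> 0" for n by (auto simp: a_def)
  qed (auto simp: fourier_add f g a eq intro!: summable_on_add)
  then show ?thesis by (simp add: fun_eq_iff)
qed

section \<open>Sequences measured against a subexponential weight\<close>

text \<open>
  Dominated convergence for unordered sums along an arbitrary filter: up to \<open>e / 4\<close> both sums are
  carried by one finite set.
\<close>
lemma tendsto_infsum_dominated:
  fixes F :: "'b \<Rightarrow> 'a \<Rightarrow> real"
  assumes lim: "\<And>j. j \<in> A \<Longrightarrow> ((\<lambda>n. F n j) \<longlongrightarrow> G j) net"
    and bound: "eventually (\<lambda>n. \<forall>j\<in>A. \<bar>F n j\<bar> \<le> b j) net"
    and b: "b summable_on A"
  shows "((\<lambda>n. infsum (F n) A) \<longlongrightarrow> infsum G A) net"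
proof (cases "net = bot")
  case False
  have G: "\<bar>G j\<bar> \<le> b j" if "j \<in> A" for j
  proof (rule tendsto_upperbound[OF _ _ False])
    show "((\<lambda>n. \<bar>F n j\<bar>) \<longlongrightarrow> \<bar>G j\<bar>) net"
      by (intro tendsto_intros lim that)
    show "eventually (\<lambda>n. \<bar>F n j\<bar> \<le> b j) net"
      using bound by eventually_elim (use that in auto)
  qed
  have b_sub: "b summable_on B" if "B \<subseteq> A" for B
    by (rule summable_on_subset_banach[OF b that])
  have dom: "h summable_on B" if "B \<subseteq> A" "\<forall>j\<in>A. \<bar>h j\<bar> \<le> b j" for h B
    using Infinite_Sum.abs_summable_on_comparison_test'[OF b_sub[OF that(1)], of h] that
    by (auto simp: summable_on_abs_iff)
  show ?thesis
  proof (rule tendstoI)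
    fix e :: real assume e: "e > 0"
    obtain S where S: "finite S" "S \<subseteq> A" "dist (sum b S) (infsum b A) \<le> e / 4"
      using infsum_finite_approximation[OF b, of "e / 4"] e by auto
    have split: "infsum h A = sum h S + infsum h (A - S)" if "\<forall>j\<in>A. \<bar>h j\<bar> \<le> b j" for h
      using infsum_Diff[OF dom[of A h] dom[of S h] S(2)] that S by simp
    have "\<forall>j\<in>A. \<bar>b j\<bar> \<le> b j"
      using G by force
    from split[OF this] S(3) have rest: "infsum b (A - S) \<le> e / 4"
      by (auto simp: dist_real_def)
    have small: "\<bar>infsum h (A - S)\<bar> \<le> e / 4" if h: "\<forall>j\<in>A. \<bar>h j\<bar> \<le> b j" for h
    proof -
      have "\<bar>infsum h (A - S)\<bar> \<le> infsum b (A - S)"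
        using norm_infsum_le[OF has_sum_infsum[OF dom[of "A - S" h]] has_sum_infsum[OF b_sub[of "A - S"]]] h
        by auto
      then show ?thesis using rest by simp
    qed
    have "((\<lambda>n. sum (F n) S) \<longlongrightarrow> sum G S) net"
      using S by (intro tendsto_sum lim) auto
    then have "eventually (\<lambda>n. dist (sum (F n) S) (sum G S) < e / 4) net"
      by (rule tendstoD) (use e in simp)
    with bound show "eventually (\<lambda>n. dist (infsum (F n) A) (infsum G A) < e) net"
    proof eventually_elim
      case (elim n)
      have "\<forall>j\<in>A. \<bar>G j\<bar> \<le> b j" using G by blast
      then show ?case
        using small[OF elim(1)] small[of G] split[OF elim(1)] split[of G] elim(2) e
        unfolding dist_real_def by linarith
    qed
  qed
qed auto

lemma filterlim_int_shift: "filterlim (\<lambda>n::int. n + k) at_top at_top"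
  unfolding filterlim_at_top eventually_at_top_linorder
  by (metis add.commute diff_add_cancel add_le_cancel_left)

lemma eventually_int_shift:
  "eventually P at_top \<Longrightarrow> eventually (\<lambda>n::int. P (n + k)) at_top"
  using filterlim_int_shift[of k] by (auto simp: filterlim_iff)

lemma tendsto_int_shift:
  "(f \<longlongrightarrow> l) at_top \<Longrightarrow> ((\<lambda>n::int. f (n + k)) \<longlongrightarrow> l) at_top"
  by (rule filterlim_compose[OF _ filterlim_int_shift])

lemma long_tail_ratio:
  fixes f :: "int \<Rightarrow> real"
  assumes pos: "eventually (\<lambda>n. f n > 0) at_top"
    and long: "((\<lambda>n. f (n + 1) / f n) \<longlongrightarrow> 1) at_top"
  shows "((\<lambda>n. f (n + k) / f n) \<longlongrightarrow> 1) at_top"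
proof -
  have up: "((\<lambda>n. f (n + int m) / f n) \<longlongrightarrow> 1) at_top" for m
  proof (induction m)
    case 0
    have "eventually (\<lambda>n. f (n + int 0) / f n = 1) at_top"
      using pos by eventually_elim simp
    then show ?case by (rule tendsto_eventually)
  next
    case (Suc m)
    have "((\<lambda>n. f (n + int m + 1) / f (n + int m) * (f (n + int m) / f n)) \<longlongrightarrow> 1 * 1) at_top"
      by (intro tendsto_mult Suc tendsto_int_shift[OF long])
    moreover have "eventually (\<lambda>n. f (n + int m + 1) / f (n + int m) * (f (n + int m) / f n)
        = f (n + int (Suc m)) / f n) at_top"
      using eventually_int_shift[OF pos, of "int m"] by eventually_elim (simp add: algebra_simps)
    ultimately have "((\<lambda>n. f (n + int (Suc m)) / f n) \<longlongrightarrow> 1 * 1) at_top"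
      by (rule Lim_transform_eventually)
    then show ?case by simp
  qed
  show ?thesis
  proof (cases "k \<ge> 0")
    case True
    then show ?thesis using up[of "nat k"] by simp
  next
    case False
    have "((\<lambda>n. inverse (f (n + k + int (nat (- k))) / f (n + k))) \<longlongrightarrow> inverse 1) at_top"
      by (intro tendsto_inverse tendsto_int_shift[OF up]) auto
    then show ?thesis using False by simp
  qed
qed

lemma infsum_atMost_tendsto:
  fixes f :: "int \<Rightarrow> real"
  assumes "ell1 f"
  shows "((\<lambda>M. infsum f {..M}) \<longlongrightarrow> infsum f UNIV) at_top"
proof -
  have "infsum f {..M} = (\<Sum>\<^sub>\<infinity>j. if j \<le> M then f j else 0)" for M
    by (rule infsum_cong_neutral) auto
  moreover have "((\<lambda>M. \<Sum>\<^sub>\<infinity>j. if j \<le> M then f j else 0) \<longlongrightarrow> infsum f UNIV) at_top"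
  proof (rule tendsto_infsum_dominated[where b = "\<lambda>j. \<bar>f j\<bar>"])
    show "((\<lambda>M. if j \<le> M then f j else 0) \<longlongrightarrow> f j) at_top" for j
      by (rule tendsto_eventually) (use eventually_ge_at_top[of j] in eventually_elim, simp)
  qed (use assms in \<open>auto simp: summable_on_abs_iff\<close>)
  ultimately show ?thesis by simp
qed

text \<open>
  For \<open>n > 2 * M\<close> at most one of \<open>j\<close> and \<open>n - j\<close> is at most \<open>M\<close>. The two infinite parts will
  yield the limits, the finite middle part is the error.
\<close>
lemma conv_split:
  assumes f: "ell1 f" and h: "ell1 h" and n: "2 * M < n"
  shows "conv f h n = (\<Sum>\<^sub>\<infinity>j\<in>{..M}. f j * h (n - j)) + (\<Sum>\<^sub>\<infinity>j\<in>{..M}. h j * f (n - j))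
    + (\<Sum>j\<in>{M<..<n - M}. f j * h (n - j))"
proof -
  have S: "(\<lambda>j. f j * h (n - j)) summable_on B" for B
    by (rule summable_on_subset_banach[OF conv_summable[OF f h]]) auto
  have U: "(UNIV :: int set) = ({..M} \<union> {n - M..}) \<union> {M<..<n - M}"
    by auto
  have "bij_betw (\<lambda>j. n - j) {..M} {n - M..}"
    by (rule bij_betwI[where g = "\<lambda>j. n - j"]) auto
  from infsum_reindex_bij_betw[OF this, of "\<lambda>j. f j * h (n - j)"]
  have "(\<Sum>\<^sub>\<infinity>j\<in>{n - M..}. f j * h (n - j)) = (\<Sum>\<^sub>\<infinity>j\<in>{..M}. h j * f (n - j))"
    by (simp add: mult.commute)
  moreover have "infsum (\<lambda>j. f j * h (n - j)) (({..M} \<union> {n - M..}) \<union> {M<..<n - M}) =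
     infsum (\<lambda>j. f j * h (n - j)) {..M} + infsum (\<lambda>j. f j * h (n - j)) {n - M..}
     + infsum (\<lambda>j. f j * h (n - j)) {M<..<n - M}"
    using n by (subst infsum_Un_disjoint[OF S S], force, subst infsum_Un_disjoint[OF S S]) auto
  ultimately show ?thesis
    unfolding conv_def by (subst U) simp
qed

text \<open>
  The weight \<open>w\<close> is long-tailed, and by \<open>w_middle\<close> two independent variables with masses \<open>w\<close> have a
  large sum only if one of them stays bounded. The set \<open>I\<close> carries the sequences that are compared
  with \<open>w\<close>. Assumption \<open>w_dominates\<close> controls \<open>w (n - i)\<close> for negative \<open>i \<in> I\<close>: it is almost
  monotonicity of \<open>w\<close> for \<open>I = UNIV\<close> and vacuous for \<open>I = {0..}\<close>.
\<close>
locale subexp_weight =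
  fixes w :: "int \<Rightarrow> real" and I :: "int set"
  assumes w_nonneg: "w n \<ge> 0"
    and w_ell1: "ell1 w"
    and w_pos: "eventually (\<lambda>n. w n > 0) at_top"
    and w_long: "((\<lambda>n. w (n + 1) / w n) \<longlongrightarrow> 1) at_top"
    and w_middle: "e > 0 \<Longrightarrow> \<exists>M. \<forall>\<^sub>F n in at_top. (\<Sum>j\<in>{M<..<n - M}. w j * w (n - j)) \<le> e * w n"
    and w_dominates: "\<exists>K. \<forall>\<^sub>F n in at_top. \<forall>i\<in>I. i < 0 \<longrightarrow> w (n - i) \<le> K * w n"
    and I_0: "0 \<in> I"
    and I_add: "i \<in> I \<Longrightarrow> j \<in> I \<Longrightarrow> i + j \<in> I"
begin

definition supported :: "(int \<Rightarrow> real) \<Rightarrow> bool" where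
  "supported f \<longleftrightarrow> (\<forall>n. n \<notin> I \<longrightarrow> f n = 0)"

definition bigO_w :: "(int \<Rightarrow> real) \<Rightarrow> bool" where
  "bigO_w f \<longleftrightarrow> (\<exists>C. eventually (\<lambda>n. \<bar>f n\<bar> \<le> C * w n) at_top)"

definition ratio_lim :: "(int \<Rightarrow> real) \<Rightarrow> real \<Rightarrow> bool" where
  "ratio_lim f a \<longleftrightarrow> ell1 f \<and> supported f \<and> ((\<lambda>n. f n / w n) \<longlongrightarrow> a) at_top"

lemma tendsto_ratio_bigO:
  assumes "((\<lambda>n. f n / w n) \<longlongrightarrow> a) at_top"
  shows "bigO_w f"
proof -
  have "eventually (\<lambda>n. \<bar>f n / w n\<bar> < \<bar>a\<bar> + 1) at_top"
    by (rule order_tendstoD(2)[OF tendsto_rabs[OF assms]]) simp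
  with w_pos have "eventually (\<lambda>n. \<bar>f n\<bar> \<le> (\<bar>a\<bar> + 1) * w n) at_top"
    by eventually_elim (auto simp: field_simps)
  then show ?thesis by (auto simp: bigO_w_def)
qed

lemma bigO_wE:
  assumes "bigO_w f"
  obtains C N where "C \<ge> 0" "\<And>n. n \<ge> N \<Longrightarrow> \<bar>f n\<bar> \<le> C * w n"
proof -
  obtain C N where CN: "\<And>n. n \<ge> N \<Longrightarrow> \<bar>f n\<bar> \<le> C * w n"
    using assms by (auto simp: bigO_w_def eventually_at_top_linorder)
  have "\<bar>f n\<bar> \<le> \<bar>C\<bar> * w n" if "n \<ge> N" for n
    using CN[OF that] mult_right_mono[OF abs_ge_self[of C] w_nonneg[of n]] by linarith
  then show ?thesis using that[of "\<bar>C\<bar>" N] by simp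
qed

lemma w_ratio: "((\<lambda>n. w (n - i) / w n) \<longlongrightarrow> 1) at_top"
  using long_tail_ratio[OF w_pos w_long, of "- i"] by simp

text \<open>
  Negative shifts are bounded by \<open>w_dominates\<close>, and the finitely many shifts in \<open>{0..M}\<close> by
  long-tailedness.
\<close>
lemma shifts_dominated:
  assumes h: "bigO_w h"
  obtains B where "B \<ge> 0" "eventually (\<lambda>n. \<forall>i\<in>I. i \<le> M \<longrightarrow> \<bar>h (n - i)\<bar> \<le> B * w n) at_top"
proof -
  obtain C N where C: "C \<ge> 0" and CN: "\<And>n. n \<ge> N \<Longrightarrow> \<bar>h n\<bar> \<le> C * w n"
    using bigO_wE[OF h] by blast
  obtain K where K: "\<forall>\<^sub>F n in at_top. \<forall>i\<in>I. i < 0 \<longrightarrow> w (n - i) \<le> K * w n"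
    using w_dominates by blast
  have "\<forall>\<^sub>F n in at_top. \<forall>i\<in>{0..M}. w (n - i) / w n < 2"
    by (intro eventually_ball_finite ballI order_tendstoD(2)[OF w_ratio]) auto
  with K w_pos eventually_ge_at_top[of "N + \<bar>M\<bar>"]
  have "eventually (\<lambda>n. \<forall>i\<in>I. i \<le> M \<longrightarrow> \<bar>h (n - i)\<bar> \<le> (C * max K 2) * w n) at_top"
  proof eventually_elim
    case (elim n)
    show ?case
    proof (intro ballI impI)
      fix i assume i: "i \<in> I" "i \<le> M"
      have "w (n - i) \<le> max K 2 * w n"
      proof (cases "i < 0")
        case True
        then have "w (n - i) \<le> K * w n" using elim i by auto
        also have "\<dots> \<le> max K 2 * w n" by (intro mult_right_mono w_nonneg) auto
        finally show ?thesis .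
      next
        case False
        then have "w (n - i) / w n < 2" using elim i by auto
        then have "w (n - i) \<le> 2 * w n" using elim by (simp add: field_simps)
        also have "\<dots> \<le> max K 2 * w n" by (intro mult_right_mono w_nonneg) auto
        finally show ?thesis .
      qed
      then have "C * w (n - i) \<le> C * (max K 2 * w n)"
        using C by (rule mult_left_mono)
      moreover have "n - i \<ge> N" using i elim by linarith
      ultimately show "\<bar>h (n - i)\<bar> \<le> (C * max K 2) * w n"
        using CN[of "n - i"] by (simp add: mult.assoc)
    qed
  qed
  moreover have "C * max K 2 \<ge> 0" using C by simp
  ultimately show ?thesis using that by blast
qed

text \<open>
  Each summand tends to \<open>f j * b\<close> because \<open>h (n - j)\<close> and \<open>h n\<close> have the same asymptotics;
  \<open>shifts_dominated\<close> provides the majorant.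
\<close>
lemma low_part_tendsto:
  assumes f: "ell1 f" "supported f" and h: "((\<lambda>n. h n / w n) \<longlongrightarrow> b) at_top"
  shows "((\<lambda>n. (\<Sum>\<^sub>\<infinity>j\<in>{..M}. f j * h (n - j)) / w n) \<longlongrightarrow> b * infsum f {..M}) at_top"
proof -
  obtain B where B: "B \<ge> 0"
    and ev: "eventually (\<lambda>n. \<forall>i\<in>I. i \<le> M \<longrightarrow> \<bar>h (n - i)\<bar> \<le> B * w n) at_top"
    using shifts_dominated[OF tendsto_ratio_bigO[OF h]] .
  have "((\<lambda>n. \<Sum>\<^sub>\<infinity>j\<in>{..M}. f j * h (n - j) / w n) \<longlongrightarrow> (\<Sum>\<^sub>\<infinity>j\<in>{..M}. f j * b)) at_top"
  proof (rule tendsto_infsum_dominated[where b = "\<lambda>j. \<bar>f j\<bar> * B"])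
    fix j assume "j \<in> {..M}"
    have "((\<lambda>n. f j * (h (n - j) / w (n - j) * (w (n - j) / w n))) \<longlongrightarrow> f j * (b * 1)) at_top"
      using tendsto_int_shift[OF h, of "- j"] by (intro tendsto_intros w_ratio) auto
    moreover have "eventually (\<lambda>n. f j * (h (n - j) / w (n - j) * (w (n - j) / w n)) = f j * h (n - j) / w n) at_top"
      using eventually_int_shift[OF w_pos, of "- j"] by eventually_elim simp
    ultimately have "((\<lambda>n. f j * h (n - j) / w n) \<longlongrightarrow> f j * (b * 1)) at_top"
      by (rule Lim_transform_eventually)
    then show "((\<lambda>n. f j * h (n - j) / w n) \<longlongrightarrow> f j * b) at_top" by simp
  next
    show "eventually (\<lambda>n. \<forall>j\<in>{..M}. \<bar>f j * h (n - j) / w n\<bar> \<le> \<bar>f j\<bar> * B) at_top"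
      using ev w_pos
    proof eventually_elim
      case (elim n)
      show ?case
      proof
        fix j assume j: "j \<in> {..M}"
        show "\<bar>f j * h (n - j) / w n\<bar> \<le> \<bar>f j\<bar> * B"
        proof (cases "j \<in> I")
          case True
          then have "\<bar>h (n - j)\<bar> / w n \<le> B" using elim j by (auto simp: field_simps)
          from mult_left_mono[OF this abs_ge_zero[of "f j"]] show ?thesis
            using elim by (simp add: abs_mult)
        qed (use f B in \<open>auto simp: supported_def\<close>)
      qed
    qed
  next
    show "(\<lambda>j. \<bar>f j\<bar> * B) summable_on {..M}"
      by (rule summable_on_cmult_left, subst summable_on_abs_iff,
          rule summable_on_subset_banach[OF f(1)]) auto
  qed
  then show ?thesis
    by (simp only: divide_inverse infsum_cmult_left' mult.commute[of b])
qed

text \<open>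
  Beyond \<open>M\<close> both factors are bounded by multiples of \<open>w\<close>, so \<open>w_middle\<close> passes to them. In
  \<open>C * D + 1\<close> the \<open>1\<close> avoids a division by zero.
\<close>
lemma middle_small:
  assumes f: "bigO_w f" and h: "bigO_w h" and e: "e > 0"
  obtains M0 where "M0 \<ge> 0"
    "\<And>M. M \<ge> M0 \<Longrightarrow> eventually (\<lambda>n. (\<Sum>j\<in>{M<..<n - M}. \<bar>f j\<bar> * \<bar>h (n - j)\<bar>) \<le> e * w n) at_top"
proof -
  obtain C N where C: "C \<ge> 0" and CN: "\<And>n. n \<ge> N \<Longrightarrow> \<bar>f n\<bar> \<le> C * w n"
    using bigO_wE[OF f] by blast
  obtain D L where D: "D \<ge> 0" and DL: "\<And>n. n \<ge> L \<Longrightarrow> \<bar>h n\<bar> \<le> D * w n"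
    using bigO_wE[OF h] by blast
  have e': "e / (C * D + 1) > 0" using e C D by (simp add: add_nonneg_pos)
  from w_middle[OF this]
  obtain M1 where M1: "\<forall>\<^sub>F n in at_top. (\<Sum>j\<in>{M1<..<n - M1}. w j * w (n - j)) \<le> e / (C * D + 1) * w n" ..
  show ?thesis
  proof (rule that[of "max 0 (max M1 (max N L))"])
    fix M assume M: "M \<ge> max 0 (max M1 (max N L))"
    show "eventually (\<lambda>n. (\<Sum>j\<in>{M<..<n - M}. \<bar>f j\<bar> * \<bar>h (n - j)\<bar>) \<le> e * w n) at_top"
      using M1
    proof eventually_elim
      case (elim n)
      have "(\<Sum>j\<in>{M<..<n - M}. \<bar>f j\<bar> * \<bar>h (n - j)\<bar>) \<le> (\<Sum>j\<in>{M<..<n - M}. (C * w j) * (D * w (n - j)))"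
        using M C D by (intro sum_mono mult_mono CN DL) (auto simp: w_nonneg)
      also have "\<dots> = C * D * (\<Sum>j\<in>{M<..<n - M}. w j * w (n - j))"
        by (simp add: sum_distrib_left mult_ac)
      also have "\<dots> \<le> C * D * (\<Sum>j\<in>{M1<..<n - M1}. w j * w (n - j))"
        using M C D by (intro mult_left_mono sum_mono2) (auto simp: w_nonneg)
      also have "\<dots> \<le> C * D * (e / (C * D + 1) * w n)"
        using C D by (intro mult_left_mono elim) auto
      also have "\<dots> = (C * D / (C * D + 1)) * (e * w n)" by simp
      also have "\<dots> \<le> 1 * (e * w n)"
        using C D e w_nonneg[of n] by (intro mult_right_mono) (auto simp: divide_le_eq_1 add_nonneg_pos)
      finally show ?case by simp
    qed
  qed simp
qed

lemma supported_conv: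
  assumes "supported f" "supported h"
  shows "supported (conv f h)"
  unfolding supported_def
proof (intro allI impI)
  fix n assume n: "n \<notin> I"
  have "f j * h (n - j) = 0" for j
    using I_add[of j "n - j"] n assms by (auto simp: supported_def)
  then show "conv f h n = 0" unfolding conv_def by (intro infsum_0)
qed

lemma supported_unit: "supported unit_seq"
  using I_0 by (auto simp: supported_def unit_seq_def)

lemma supported_seq_pow: "supported f \<Longrightarrow> supported (seq_pow f k)"
  by (induction k) (auto intro: supported_conv supported_unit)

text \<open>
  One big jump: if \<open>j\<close> is bounded then \<open>h (n - j)\<close> contributes \<open>b * w n\<close>, if \<open>n - j\<close> is bounded then
  \<open>f j\<close> contributes \<open>a * w n\<close>, and the rest is negligible.
\<close>
lemma ratio_lim_conv:
  assumes f: "ratio_lim f a" and h: "ratio_lim h b"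
  shows "ratio_lim (conv f h) (a * infsum h UNIV + b * infsum f UNIV)"
proof -
  have f': "ell1 f" "supported f" "((\<lambda>n. f n / w n) \<longlongrightarrow> a) at_top"
    and h': "ell1 h" "supported h" "((\<lambda>n. h n / w n) \<longlongrightarrow> b) at_top"
    using f h by (auto simp: ratio_lim_def)
  have "((\<lambda>n. conv f h n / w n) \<longlongrightarrow> a * infsum h UNIV + b * infsum f UNIV) at_top"
  proof (rule tendstoI)
    fix e :: real assume e: "e > 0"
    obtain M0 where M0: "\<And>M. M \<ge> M0 \<Longrightarrow>
        eventually (\<lambda>n. (\<Sum>j\<in>{M<..<n - M}. \<bar>f j\<bar> * \<bar>h (n - j)\<bar>) \<le> e / 3 * w n) at_top"
      using middle_small[OF tendsto_ratio_bigO[OF f'(3)] tendsto_ratio_bigO[OF h'(3)], of "e / 3"] e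
      by auto
    have "((\<lambda>M. a * infsum h {..M} + b * infsum f {..M}) \<longlongrightarrow> a * infsum h UNIV + b * infsum f UNIV) at_top"
      by (intro tendsto_intros infsum_atMost_tendsto f' h')
    from tendstoD[OF this, of "e / 3"] e
    have "eventually (\<lambda>M. dist (a * infsum h {..M} + b * infsum f {..M})
        (a * infsum h UNIV + b * infsum f UNIV) < e / 3) at_top" by simp
    with eventually_ge_at_top[of M0]
    have "eventually (\<lambda>M. M \<ge> M0 \<and> dist (a * infsum h {..M} + b * infsum f {..M})
        (a * infsum h UNIV + b * infsum f UNIV) < e / 3) at_top"
      by eventually_elim simp
    then obtain M where M: "M \<ge> M0" "dist (a * infsum h {..M} + b * infsum f {..M})
        (a * infsum h UNIV + b * infsum f UNIV) < e / 3"
      using eventually_happens[of _ "at_top :: int filter"] by auto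
    have "((\<lambda>n. (\<Sum>\<^sub>\<infinity>j\<in>{..M}. h j * f (n - j)) / w n + (\<Sum>\<^sub>\<infinity>j\<in>{..M}. f j * h (n - j)) / w n)
        \<longlongrightarrow> a * infsum h {..M} + b * infsum f {..M}) at_top"
      by (intro tendsto_add low_part_tendsto f' h')
    from tendstoD[OF this, of "e / 3"] e
    have "eventually (\<lambda>n. dist ((\<Sum>\<^sub>\<infinity>j\<in>{..M}. h j * f (n - j)) / w n + (\<Sum>\<^sub>\<infinity>j\<in>{..M}. f j * h (n - j)) / w n)
        (a * infsum h {..M} + b * infsum f {..M}) < e / 3) at_top" by simp
    with M0[OF M(1)] w_pos eventually_gt_at_top[of "2 * M"]
    show "eventually (\<lambda>n. dist (conv f h n / w n) (a * infsum h UNIV + b * infsum f UNIV) < e) at_top"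
    proof eventually_elim
      case (elim n)
      have "\<bar>\<Sum>j\<in>{M<..<n - M}. f j * h (n - j)\<bar> \<le> (\<Sum>j\<in>{M<..<n - M}. \<bar>f j\<bar> * \<bar>h (n - j)\<bar>)"
        by (rule order_trans[OF sum_abs]) (simp add: abs_mult)
      with elim have mid: "\<bar>(\<Sum>j\<in>{M<..<n - M}. f j * h (n - j)) / w n\<bar> \<le> e / 3"
        by (simp add: field_simps)
      have "conv f h n / w n = ((\<Sum>\<^sub>\<infinity>j\<in>{..M}. h j * f (n - j)) / w n + (\<Sum>\<^sub>\<infinity>j\<in>{..M}. f j * h (n - j)) / w n)
          + (\<Sum>j\<in>{M<..<n - M}. f j * h (n - j)) / w n"
        using conv_split[OF f'(1) h'(1) elim(3)] by (simp add: add_divide_distrib)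
      then show ?case
        using mid M(2) elim(4) unfolding dist_real_def by linarith
    qed
  qed
  then show ?thesis
    using f' h' by (simp add: ratio_lim_def ell1_conv supported_conv)
qed

lemma ratio_lim_unit: "ratio_lim unit_seq 0"
proof -
  have "eventually (\<lambda>n. unit_seq n / w n = 0) at_top"
    using eventually_gt_at_top[of 0] by eventually_elim (simp add: unit_seq_def)
  then show ?thesis
    by (simp add: ratio_lim_def supported_unit tendsto_eventually)
qed

text \<open>
  The map from \<open>f\<close> to its ratio limit is a derivation over the functional \<open>f \<mapsto> \<Sum>f\<close>, so the power rule
  holds.
\<close>
lemma ratio_lim_seq_pow:
  assumes "ratio_lim f a"
  shows "ratio_lim (seq_pow f k) (a * (of_nat k * infsum f UNIV ^ (k - 1)))"
proof (induction k)
  case (Suc k)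
  have "ell1 f" using assms by (simp add: ratio_lim_def)
  have "ratio_lim (seq_pow f (Suc k)) (a * infsum (seq_pow f k) UNIV + a * (of_nat k * infsum f UNIV ^ (k - 1)) * infsum f UNIV)"
    using ratio_lim_conv[OF assms Suc] by simp
  also have "a * infsum (seq_pow f k) UNIV + a * (of_nat k * infsum f UNIV ^ (k - 1)) * infsum f UNIV =
      a * (of_nat (Suc k) * infsum f UNIV ^ (Suc k - 1))"
    by (cases k) (simp_all add: infsum_seq_pow[OF \<open>ell1 f\<close>] algebra_simps del: seq_pow.simps)
  finally show ?case .
qed (simp add: ratio_lim_unit)

text \<open>
  The constant only has to exceed the norm of \<open>f\<close>: the part \<open>j \<le> M\<close> is asymptotically at most
  \<open>l1 f * w n\<close>, and the part between \<open>M\<close> and \<open>n - M\<close> is small.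
\<close>
lemma long_shifts_bounded:
  assumes f: "ell1 f" "supported f" "bigO_w f" and r: "l1 f < r"
  obtains N0 where "\<And>N n. N \<ge> N0 \<Longrightarrow> n \<ge> N \<Longrightarrow> (\<Sum>\<^sub>\<infinity>j\<in>{..n - N}. \<bar>f j\<bar> * w (n - j)) \<le> r * w n"
proof -
  define e where "e = (r - l1 f) / 2"
  have e: "e > 0" using r by (simp add: e_def)
  have F: "ell1 (\<lambda>j. \<bar>f j\<bar>)" "supported (\<lambda>j. \<bar>f j\<bar>)" "bigO_w (\<lambda>j. \<bar>f j\<bar>)"
    using f by (auto simp: summable_on_abs_iff supported_def bigO_w_def)
  have ww: "((\<lambda>n. w n / w n) \<longlongrightarrow> 1) at_top"
    using w_ratio[of 0] by simp
  obtain M where M: "M \<ge> 0" "\<And>M'. M' \<ge> M \<Longrightarrow>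
      eventually (\<lambda>n. (\<Sum>j\<in>{M'<..<n - M'}. \<bar>f j\<bar> * \<bar>w (n - j)\<bar>) \<le> e * w n) at_top"
    using middle_small[OF f(3) tendsto_ratio_bigO[OF ww] e] by blast
  note mid = M(2)[OF order_refl]
  have "infsum (\<lambda>j. \<bar>f j\<bar>) {..M} \<le> l1 f"
    unfolding l1_def
    by (rule infsum_mono2[OF summable_on_subset_banach[OF F(1)] F(1)]) auto
  then have "1 * infsum (\<lambda>j. \<bar>f j\<bar>) {..M} < l1 f + e"
    using e by simp
  from order_tendstoD(2)[OF low_part_tendsto[OF F(1,2) ww] this]
  have "eventually (\<lambda>n. (\<Sum>\<^sub>\<infinity>j\<in>{..M}. \<bar>f j\<bar> * w (n - j)) / w n < l1 f + e) at_top" .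
  with mid w_pos have
    "eventually (\<lambda>n. (\<Sum>j\<in>{M<..<n - M}. \<bar>f j\<bar> * w (n - j)) \<le> e * w n \<and>
       (\<Sum>\<^sub>\<infinity>j\<in>{..M}. \<bar>f j\<bar> * w (n - j)) \<le> (l1 f + e) * w n) at_top"
    by eventually_elim (auto simp: w_nonneg field_simps)
  then obtain N1 where N1: "\<And>n. n \<ge> N1 \<Longrightarrow> (\<Sum>j\<in>{M<..<n - M}. \<bar>f j\<bar> * w (n - j)) \<le> e * w n"
       "\<And>n. n \<ge> N1 \<Longrightarrow> (\<Sum>\<^sub>\<infinity>j\<in>{..M}. \<bar>f j\<bar> * w (n - j)) \<le> (l1 f + e) * w n"
    by (auto simp: eventually_at_top_linorder)
  show ?thesis
  proof (rule that[of "max N1 (M + 1)"])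
    fix N n assume Nn: "N \<ge> max N1 (M + 1)" "n \<ge> N"
    have S: "(\<lambda>j. \<bar>f j\<bar> * w (n - j)) summable_on B" for B
      by (rule summable_on_subset_banach[OF conv_summable[OF F(1) w_ell1]]) auto
    have "(\<Sum>\<^sub>\<infinity>j\<in>{..n - N}. \<bar>f j\<bar> * w (n - j)) \<le> (\<Sum>\<^sub>\<infinity>j\<in>{..M} \<union> {M<..<n - M}. \<bar>f j\<bar> * w (n - j))"
      using Nn by (intro infsum_mono2 S) (auto simp: w_nonneg)
    also have "\<dots> = (\<Sum>\<^sub>\<infinity>j\<in>{..M}. \<bar>f j\<bar> * w (n - j)) + (\<Sum>j\<in>{M<..<n - M}. \<bar>f j\<bar> * w (n - j))"
      by (subst infsum_Un_disjoint[OF S S]) auto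
    also have "\<dots> \<le> (l1 f + e) * w n + e * w n"
      using N1 Nn by (intro add_mono) auto
    also have "\<dots> = r * w n" by (simp add: e_def field_simps)
    finally show "(\<Sum>\<^sub>\<infinity>j\<in>{..n - N}. \<bar>f j\<bar> * w (n - j)) \<le> r * w n" .
  qed
qed

text \<open>
  A version of \<open>shifts_dominated\<close> for all \<open>n \<ge> N\<close> with \<open>N\<close> given in advance, as the induction for
  \<open>seq_pow_bound\<close> must use one threshold for all exponents. The finitely many missing \<open>n\<close> are absorbed
  by enlarging the constant.
\<close>
lemma shifts_dominated_from:
  assumes f: "ell1 f" "bigO_w f" and N: "\<And>n. n \<ge> N \<Longrightarrow> w n > 0"
  obtains B where "B \<ge> 0" "\<And>n i. n \<ge> N \<Longrightarrow> i \<in> I \<Longrightarrow> i < N \<Longrightarrow> \<bar>f (n - i)\<bar> \<le> B * w n"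
proof -
  obtain B where B: "B \<ge> 0"
    and ev: "eventually (\<lambda>n. \<forall>i\<in>I. i \<le> N \<longrightarrow> \<bar>f (n - i)\<bar> \<le> B * w n) at_top"
    using shifts_dominated[OF f(2)] .
  then obtain N' where N': "\<And>n i. n \<ge> N' \<Longrightarrow> i \<in> I \<Longrightarrow> i \<le> N \<Longrightarrow> \<bar>f (n - i)\<bar> \<le> B * w n"
    by (auto simp: eventually_at_top_linorder)
  define B' where "B' = B + (\<Sum>n\<in>{N..<N'}. l1 f / w n)"
  have nn: "(\<Sum>n\<in>{N..<N'}. l1 f / w n) \<ge> 0"
    by (intro sum_nonneg) (auto simp: w_nonneg)
  show ?thesis
  proof (rule that[of B'])
    show "B' \<ge> 0" using nn B by (simp add: B'_def)
    fix n i assume n: "n \<ge> N" "i \<in> I" "i < N"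
    show "\<bar>f (n - i)\<bar> \<le> B' * w n"
    proof (cases "n \<ge> N'")
      case True
      then have "\<bar>f (n - i)\<bar> \<le> B * w n" using N' n by auto
      also have "\<dots> \<le> B' * w n" using nn by (intro mult_right_mono w_nonneg) (simp add: B'_def)
      finally show ?thesis .
    next
      case False
      have "\<bar>f (n - i)\<bar> \<le> l1 f / w n * w n" using abs_le_l1[OF f(1), of "n - i"] N[OF n(1)] by simp
      also have "\<dots> \<le> B' * w n"
      proof (intro mult_right_mono w_nonneg)
        have "l1 f / w n \<le> (\<Sum>n\<in>{N..<N'}. l1 f / w n)"
          using False n by (intro member_le_sum) (auto simp: w_nonneg)
        then show "l1 f / w n \<le> B'" using B by (simp add: B'_def)
      qed
      finally show ?thesis .
    qed
  qed
qed

text \<open>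
  Kesten's bound. With \<open>b\<^sub>k\<close> the best constant for the \<open>k\<close>-th power beyond \<open>N\<close>, splitting the convolution
  at \<open>n - N\<close> gives \<open>b\<^sub>k\<^sub>+\<^sub>1 \<le> r' * b\<^sub>k + B * (l1 f)\<^sup>k\<close> with \<open>l1 f < r' < r\<close>: the induction hypothesis
  covers \<open>n - j \<ge> N\<close>, and otherwise \<open>f j\<close> itself is of the order of \<open>w n\<close>.
\<close>
lemma seq_pow_bound:
  assumes f: "ell1 f" "supported f" "bigO_w f" and r: "l1 f < r"
  obtains C N where "C \<ge> 0" "\<And>n k. n \<ge> N \<Longrightarrow> \<bar>seq_pow f k n\<bar> \<le> C * r ^ k * w n"
proof -
  define r' where "r' = (l1 f + r) / 2"
  have r': "l1 f < r'" "r' < r" "0 \<le> r'" using r add_nonneg_nonneg[OF l1_nonneg[of f] order_trans[OF l1_nonneg less_imp_le[OF r]]]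
    by (simp_all add: r'_def)
  obtain N0 where N0: "\<And>N n. N \<ge> N0 \<Longrightarrow> n \<ge> N \<Longrightarrow> (\<Sum>\<^sub>\<infinity>j\<in>{..n - N}. \<bar>f j\<bar> * w (n - j)) \<le> r' * w n"
    using long_shifts_bounded[OF f r'(1)] by blast
  obtain N1 where N1: "\<And>n. n \<ge> N1 \<Longrightarrow> w n > 0"
    using w_pos by (auto simp: eventually_at_top_linorder)
  define N where "N = max (max N0 N1) 1"
  have N: "N \<ge> N0" "N \<ge> 1" "\<And>n. n \<ge> N \<Longrightarrow> w n > 0" using N1 by (auto simp: N_def)
  obtain B where B: "B \<ge> 0" "\<And>n i. n \<ge> N \<Longrightarrow> i \<in> I \<Longrightarrow> i < N \<Longrightarrow> \<bar>f (n - i)\<bar> \<le> B * w n"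
    using shifts_dominated_from[OF f(1,3) N(3)] by blast
  \<comment> \<open>the solution of \<open>C * r' + B = C * r\<close>, so the recursion preserves the bound \<open>C * r\<^sup>k\<close>\<close>
  define C where "C = B / (r - r')"
  have C: "C \<ge> 0" "C * r' + B = C * r" using B r' by (auto simp: C_def field_simps)
  have "\<bar>seq_pow f k n\<bar> \<le> C * r ^ k * w n" if "n \<ge> N" for n k
    using that
  proof (induction k arbitrary: n)
    case 0
    then show ?case using N C w_nonneg[of n] by (auto simp: unit_seq_def)
  next
    case (Suc k)
    let ?p = "seq_pow f k"
    have p: "ell1 ?p" "supported ?p" using f by (auto intro: ell1_seq_pow supported_seq_pow)
    have P: "ell1 (\<lambda>j. \<bar>?p j\<bar>)" and F: "ell1 (\<lambda>j. \<bar>f j\<bar>)"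
      using p f by (auto simp: summable_on_abs_iff)
    have S: "(\<lambda>j. \<bar>f j\<bar> * \<bar>?p (n - j)\<bar>) summable_on A" for A
      by (rule summable_on_subset_banach[OF conv_summable[OF F P]]) auto
    have Sw: "(\<lambda>j. \<bar>f j\<bar> * w (n - j)) summable_on A" for A
      by (rule summable_on_subset_banach[OF conv_summable[OF F w_ell1]]) auto
    have bij: "bij_betw (\<lambda>j. n - j) UNIV (UNIV :: int set)"
      by (rule bij_betwI[where g = "\<lambda>j. n - j"]) auto
    have Sp: "(\<lambda>j. \<bar>?p (n - j)\<bar>) summable_on UNIV"
      using summable_on_reindex_bij_betw[OF bij, of "\<lambda>j. \<bar>?p j\<bar>"] P by simp
    have "\<bar>seq_pow f (Suc k) n\<bar> \<le> (\<Sum>\<^sub>\<infinity>j. \<bar>f j\<bar> * \<bar>?p (n - j)\<bar>)"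
      using norm_infsum_bound[of "\<lambda>j. f j * ?p (n - j)" UNIV] S[of UNIV]
      by (simp add: conv_def abs_mult)
    also have "\<dots> = (\<Sum>\<^sub>\<infinity>j\<in>{..n - N} \<union> {n - N<..}. \<bar>f j\<bar> * \<bar>?p (n - j)\<bar>)"
      by (rule arg_cong[where f = "infsum _"]) auto
    also have "\<dots> = (\<Sum>\<^sub>\<infinity>j\<in>{..n - N}. \<bar>f j\<bar> * \<bar>?p (n - j)\<bar>) + (\<Sum>\<^sub>\<infinity>j\<in>{n - N<..}. \<bar>f j\<bar> * \<bar>?p (n - j)\<bar>)"
      by (rule infsum_Un_disjoint[OF S S]) auto
    also have "\<dots> \<le> C * r ^ k * (r' * w n) + B * w n * r ^ k"
    proof (rule add_mono)
      have "(\<Sum>\<^sub>\<infinity>j\<in>{..n - N}. \<bar>f j\<bar> * \<bar>?p (n - j)\<bar>) \<le> (\<Sum>\<^sub>\<infinity>j\<in>{..n - N}. (C * r ^ k) * (\<bar>f j\<bar> * w (n - j)))"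
      proof (rule infsum_mono[OF S summable_on_cmult_right[OF Sw]])
        fix j assume "j \<in> {..n - N}"
        then have "\<bar>?p (n - j)\<bar> \<le> C * r ^ k * w (n - j)" by (intro Suc.IH) auto
        from mult_left_mono[OF this abs_ge_zero[of "f j"]]
        show "\<bar>f j\<bar> * \<bar>?p (n - j)\<bar> \<le> (C * r ^ k) * (\<bar>f j\<bar> * w (n - j))" by (simp add: mult_ac)
      qed
      also have "\<dots> = C * r ^ k * (\<Sum>\<^sub>\<infinity>j\<in>{..n - N}. \<bar>f j\<bar> * w (n - j))"
        by (rule infsum_cmult_right')
      also have "\<dots> \<le> C * r ^ k * (r' * w n)"
        using N Suc.prems C r' by (intro mult_left_mono N0) auto
      finally show "(\<Sum>\<^sub>\<infinity>j\<in>{..n - N}. \<bar>f j\<bar> * \<bar>?p (n - j)\<bar>) \<le> C * r ^ k * (r' * w n)" .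
    next
      have "(\<Sum>\<^sub>\<infinity>j\<in>{n - N<..}. \<bar>f j\<bar> * \<bar>?p (n - j)\<bar>) \<le> (\<Sum>\<^sub>\<infinity>j. (B * w n) * \<bar>?p (n - j)\<bar>)"
      proof (rule infsum_mono_neutral[OF S summable_on_cmult_right[OF Sp]])
        fix j assume j: "j \<in> {n - N<..} \<inter> UNIV"
        show "\<bar>f j\<bar> * \<bar>?p (n - j)\<bar> \<le> (B * w n) * \<bar>?p (n - j)\<bar>"
        proof (cases "n - j \<in> I")
          case True
          then have "\<bar>f (n - (n - j))\<bar> \<le> B * w n" using j Suc.prems by (intro B) auto
          then show ?thesis by (intro mult_right_mono) auto
        qed (use p in \<open>auto simp: supported_def\<close>)
      qed (use B w_nonneg in auto)
      also have "\<dots> = B * w n * l1 ?p"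
        using infsum_reindex_bij_betw[OF bij, of "\<lambda>j. \<bar>?p j\<bar>"] by (simp add: infsum_cmult_right' l1_def)
      also have "\<dots> \<le> B * w n * r ^ k"
      proof (intro mult_left_mono)
        have "l1 ?p \<le> l1 f ^ k" by (rule l1_seq_pow_le[OF f(1)])
        also have "\<dots> \<le> r ^ k" using r by (intro power_mono) auto
        finally show "l1 ?p \<le> r ^ k" .
      qed (use B w_nonneg in auto)
      finally show "(\<Sum>\<^sub>\<infinity>j\<in>{n - N<..}. \<bar>f j\<bar> * \<bar>?p (n - j)\<bar>) \<le> B * w n * r ^ k" .
    qed
    also have "\<dots> = (C * r' + B) * r ^ k * w n" by (simp add: algebra_simps)
    also have "\<dots> = C * r ^ Suc k * w n" by (simp add: C)
    finally show ?case .
  qed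
  then show ?thesis using that C by blast
qed

text \<open>
  Tannery's theorem applied to the ratio limits of the powers, with the majorant from
  \<open>seq_pow_bound\<close>.
\<close>
lemma ratio_lim_power_series:
  assumes f: "ratio_lim f a" and r: "l1 f < r" and c: "summable (\<lambda>k. \<bar>c k\<bar> * r ^ k)"
  shows "ratio_lim (power_series c f) (a * (\<Sum>k. c k * (of_nat k * infsum f UNIV ^ (k - 1))))"
proof -
  have f': "ell1 f" "supported f" "((\<lambda>n. f n / w n) \<longlongrightarrow> a) at_top"
    using f by (auto simp: ratio_lim_def)
  have c': "summable (\<lambda>k. \<bar>c k\<bar> * l1 f ^ k)"
    by (rule summable_comparison_test'[OF c, of 0])
       (use r in \<open>auto simp: abs_mult intro!: mult_left_mono power_mono\<close>)
  obtain C N where C: "C \<ge> 0" and CN: "\<And>n k. n \<ge> N \<Longrightarrow> \<bar>seq_pow f k n\<bar> \<le> C * r ^ k * w n"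
    using seq_pow_bound[OF f'(1,2) tendsto_ratio_bigO[OF f'(3)] r] by blast
  have "eventually (\<lambda>n. n \<ge> N \<and> w n > 0) at_top"
    using w_pos eventually_ge_at_top[of N] by eventually_elim simp
  then have "eventually (\<lambda>(k::nat, n). n \<ge> N \<and> w n > 0) (at_top \<times>\<^sub>F at_top)"
    by (subst eventually_prod2) auto
  then have bound: "eventually (\<lambda>(k,n). norm (c k * seq_pow f k n / w n) \<le> C * (\<bar>c k\<bar> * r ^ k))
      (at_top \<times>\<^sub>F at_top)"
  proof (rule eventually_mono)
    fix x :: "nat \<times> int"
    assume x: "case x of (k, n) \<Rightarrow> n \<ge> N \<and> w n > 0"
    obtain k n where [simp]: "x = (k, n)" by (cases x)
    have "\<bar>seq_pow f k n\<bar> / w n \<le> C * r ^ k" using CN[of n k] x by (simp add: field_simps)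
    from mult_left_mono[OF this abs_ge_zero[of "c k"]]
    show "case x of (k, n) \<Rightarrow> norm (c k * seq_pow f k n / w n) \<le> C * (\<bar>c k\<bar> * r ^ k)"
      using x by (simp add: abs_mult mult_ac)
  qed
  have lim: "((\<lambda>n. c k * seq_pow f k n / w n) \<longlongrightarrow> c k * (a * (of_nat k * infsum f UNIV ^ (k - 1)))) at_top" for k
    using ratio_lim_seq_pow[OF f, of k] tendsto_mult_left[of "\<lambda>n. seq_pow f k n / w n" _ at_top "c k"]
    by (simp add: ratio_lim_def)
  have T: "summable (\<lambda>k. norm (c k * (a * (of_nat k * infsum f UNIV ^ (k - 1)))))"
    "((\<lambda>n. \<Sum>k. c k * seq_pow f k n / w n) \<longlongrightarrow> (\<Sum>k. c k * (a * (of_nat k * infsum f UNIV ^ (k - 1))))) at_top"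
    using tannerys_theorem[OF lim bound summable_mult[OF c]] by auto
  have "(\<Sum>k. c k * seq_pow f k n / w n) = power_series c f n / w n" for n
    unfolding power_series_def by (rule suminf_divide) (rule power_series_summable[OF f'(1) c'])
  moreover have "(\<Sum>k. c k * (a * (of_nat k * infsum f UNIV ^ (k - 1)))) =
      a * (\<Sum>k. c k * (of_nat k * infsum f UNIV ^ (k - 1)))"
  proof (cases "a = 0")
    case False
    have "summable (\<lambda>k. a * (c k * (of_nat k * infsum f UNIV ^ (k - 1))))"
      using summable_norm_cancel[OF T(1)] by (simp add: mult_ac)
    then have "summable (\<lambda>k. c k * (of_nat k * infsum f UNIV ^ (k - 1)))"
      using False by (simp add: summable_cmult_iff)
    from suminf_mult[OF this, of a] show ?thesis by (simp add: mult_ac)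
  qed simp
  moreover have "supported (power_series c f)"
    using supported_seq_pow[OF f'(2)] by (auto simp: supported_def power_series_def)
  ultimately show ?thesis
    using T(2) ell1_power_series[OF f'(1) c'] by (simp add: ratio_lim_def)
qed

end

section \<open>Subexponential probability sequences\<close>
definition seq_L :: "(int \<Rightarrow> real) \<Rightarrow> bool" where
  "seq_L f \<longleftrightarrow> eventually (\<lambda>n. f n > 0) at_top \<and> ((\<lambda>n. f (n + 1) / f n) \<longlongrightarrow> 1) at_top"

definition seq_S :: "(int \<Rightarrow> real) \<Rightarrow> bool" where
  "seq_S f \<longleftrightarrow> seq_L f \<and> ((\<lambda>n. conv f f n / f n) \<longlongrightarrow> 2) at_top"

definition seq_D :: "(int \<Rightarrow> real) \<Rightarrow> bool" where
  "seq_D f \<longleftrightarrow> (\<exists>K. eventually (\<lambda>n. \<forall>k>0. f (n + k) \<le> K * f n) at_top)"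

definition prob_seq :: "(int \<Rightarrow> real) \<Rightarrow> bool" where
  "prob_seq f \<longleftrightarrow> (\<forall>n. f n \<ge> 0) \<and> ell1 f \<and> infsum f UNIV = 1"

text \<open>
  The two settings of the theorem: sequences on all of \<open>\<int>\<close> with an almost decreasing tail, and
  sequences on the non-negative integers.
\<close>
definition admissible_tail :: "int set \<Rightarrow> (int \<Rightarrow> real) \<Rightarrow> bool" where
  "admissible_tail I f \<longleftrightarrow> I = UNIV \<and> seq_D f \<or> I = {0..}"

lemma prob_seqD:
  assumes "prob_seq f"
  shows "f n \<ge> 0" "ell1 f" "infsum f UNIV = 1" "l1 f = 1"
proof -
  show *: "f n \<ge> 0" "ell1 f" "infsum f UNIV = 1" for n using assms by (auto simp: prob_seq_def)
  show "l1 f = 1" unfolding l1_def using * by simp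
qed

lemma nonneg_finite_approx:
  fixes f :: "int \<Rightarrow> real"
  assumes f: "\<And>n. f n \<ge> 0" "ell1 f" and e: "e > 0"
  obtains S where "finite S" "sum f S \<ge> infsum f UNIV - e" "sum f S \<le> infsum f UNIV"
proof -
  obtain S where S: "finite S" "dist (sum f S) (infsum f UNIV) \<le> e"
    using infsum_finite_approximation[OF f(2) e] by auto
  moreover have "sum f S \<le> infsum f UNIV"
    using S f by (intro finite_sum_le_infsum) auto
  ultimately show ?thesis by (intro that[of S]) (auto simp: dist_real_def)
qed

lemma conv_ge_finite_parts:
  assumes f: "\<And>n. f n \<ge> 0" "ell1 f" and h: "\<And>n. h n \<ge> 0" "ell1 h"
    and S: "finite S" "S \<subseteq> {..M}" and T: "finite T" "T \<subseteq> {..M}" and n: "2 * M < n"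
  shows "(\<Sum>j\<in>S. f j * h (n - j)) + (\<Sum>j\<in>T. h j * f (n - j)) + (\<Sum>j\<in>{M<..<n - M}. f j * h (n - j))
    \<le> conv f h n"
proof -
  have A: "(\<lambda>j. f j * h (n - j)) summable_on {..M}" "(\<lambda>j. h j * f (n - j)) summable_on {..M}"
    by (rule summable_on_subset_banach[OF conv_summable], use f h in auto)+
  have "(\<Sum>j\<in>S. f j * h (n - j)) \<le> (\<Sum>\<^sub>\<infinity>j\<in>{..M}. f j * h (n - j))"
    "(\<Sum>j\<in>T. h j * f (n - j)) \<le> (\<Sum>\<^sub>\<infinity>j\<in>{..M}. h j * f (n - j))"
    using A S T f h by (auto intro!: finite_sum_le_infsum)
  then show ?thesis using conv_split[OF f(2) h(2) n] by linarith
qed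

lemma finite_sum_shift_tendsto:
  fixes f :: "int \<Rightarrow> real"
  assumes L: "seq_L f" and S: "finite S"
  shows "((\<lambda>n. (\<Sum>j\<in>S. c j * f (n - j)) / f n) \<longlongrightarrow> sum c S) at_top"
proof -
  have "((\<lambda>n. f (n + (- j)) / f n) \<longlongrightarrow> 1) at_top" for j
    by (rule long_tail_ratio) (use L in \<open>auto simp: seq_L_def\<close>)
  then have "((\<lambda>n. \<Sum>j\<in>S. c j * (f (n + (- j)) / f n)) \<longlongrightarrow> (\<Sum>j\<in>S. c j * 1)) at_top"
    by (intro tendsto_sum tendsto_mult tendsto_const)
  then show ?thesis by (simp add: sum_divide_distrib)
qed

lemma bounded_above_finite:
  assumes "finite (S :: int set)"
  obtains M where "M \<ge> 0" "S \<subseteq> {..M}"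
  using assms by (intro that[of "Max (insert 0 S)"]) auto

text \<open>
  The two outer parts of \<open>f * f\<close> already contribute almost \<open>2 * f n\<close>, by summing over a finite set that
  carries almost all the mass; since \<open>f * f\<close> is asymptotically \<open>2 * f n\<close>, nothing is left for the
  middle.
\<close>
lemma seq_S_subexp_weight:
  assumes f: "prob_seq f" and S: "seq_S f" and I: "admissible_tail I f"
  shows "subexp_weight f I"
proof -
  note f' = prob_seqD[OF f]
  have L: "seq_L f" and conv: "((\<lambda>n. conv f f n / f n) \<longlongrightarrow> 2) at_top"
    using S by (auto simp: seq_S_def)
  have pos: "eventually (\<lambda>n. f n > 0) at_top" using L by (simp add: seq_L_def)
  show ?thesis
  proof
    fix e :: real assume e: "e > 0"
    obtain S where S: "finite S" "sum f S \<ge> 1 - e / 4"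
      using nonneg_finite_approx[OF f'(1,2), of "e / 4"] e f'(3) by auto
    obtain M where M: "M \<ge> 0" "S \<subseteq> {..M}" using bounded_above_finite[OF S(1)] .
    have "((\<lambda>n. conv f f n / f n - 2 * ((\<Sum>j\<in>S. f j * f (n - j)) / f n)) \<longlongrightarrow> 2 - 2 * sum f S) at_top"
      by (intro tendsto_intros conv finite_sum_shift_tendsto L S)
    moreover have "2 - 2 * sum f S < e" using S e by linarith
    ultimately have "eventually (\<lambda>n. conv f f n / f n - 2 * ((\<Sum>j\<in>S. f j * f (n - j)) / f n) < e) at_top"
      by (rule order_tendstoD(2))
    with pos eventually_gt_at_top[of "2 * M"]
    have "\<forall>\<^sub>F n in at_top. (\<Sum>j\<in>{M<..<n - M}. f j * f (n - j)) \<le> e * f n"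
    proof eventually_elim
      case (elim n)
      have "conv f f n - 2 * (\<Sum>j\<in>S. f j * f (n - j)) \<le> e * f n"
        using elim by (simp add: field_simps)
      then show ?case
        using conv_ge_finite_parts[OF f'(1,2) f'(1,2) S(1) M(2) S(1) M(2) elim(2)] by linarith
    qed
    then show "\<exists>M. \<forall>\<^sub>F n in at_top. (\<Sum>j\<in>{M<..<n - M}. f j * f (n - j)) \<le> e * f n" ..
  next
    show "\<exists>K. \<forall>\<^sub>F n in at_top. \<forall>i\<in>I. i < 0 \<longrightarrow> f (n - i) \<le> K * f n"
      using I unfolding admissible_tail_def
    proof (elim disjE conjE)
      assume "seq_D f"
      then obtain K where "eventually (\<lambda>n. \<forall>k>0. f (n + k) \<le> K * f n) at_top"
        by (auto simp: seq_D_def)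
      then have "\<forall>\<^sub>F n in at_top. \<forall>i\<in>I. i < 0 \<longrightarrow> f (n - i) \<le> K * f n"
        by eventually_elim (metis diff_conv_add_uminus neg_0_less_iff_less)
      then show ?thesis ..
    qed auto
  qed (use f' L I in \<open>auto simp: seq_L_def admissible_tail_def\<close>)
qed

lemma
  fixes f w :: "int \<Rightarrow> real"
  assumes L: "seq_L w" and lim: "((\<lambda>n. f n / w n) \<longlongrightarrow> a) at_top" and a: "a > 0"
  shows seq_L_equiv: "seq_L f"
    and seq_D_equiv: "seq_D w \<Longrightarrow> seq_D f"
proof -
  have wpos: "eventually (\<lambda>n. w n > 0) at_top" and wlong: "((\<lambda>n. w (n + 1) / w n) \<longlongrightarrow> 1) at_top"
    using L by (auto simp: seq_L_def)
  have two: "eventually (\<lambda>n. f n / w n > a / 2) at_top" "eventually (\<lambda>n. f n / w n < 2 * a) at_top"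
    using order_tendstoD(1)[OF lim, of "a / 2"] order_tendstoD(2)[OF lim, of "2 * a"] a by auto
  from two(1) wpos have pos: "eventually (\<lambda>n. f n > 0) at_top"
  proof eventually_elim
    case (elim n)
    then have "f n / w n > 0" using a by linarith
    then show ?case using elim by (simp add: zero_less_divide_iff)
  qed
  have "((\<lambda>n. (f (n + 1) / w (n + 1)) / (f n / w n) * (w (n + 1) / w n)) \<longlongrightarrow> a / a * 1) at_top"
    using a by (intro tendsto_mult tendsto_divide tendsto_int_shift[OF lim] lim wlong) auto
  moreover have "eventually (\<lambda>n. (f (n + 1) / w (n + 1)) / (f n / w n) * (w (n + 1) / w n) = f (n + 1) / f n) at_top"
    using wpos eventually_int_shift[OF wpos, of 1] by eventually_elim simp
  ultimately have "((\<lambda>n. f (n + 1) / f n) \<longlongrightarrow> a / a * 1) at_top"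
    by (rule Lim_transform_eventually)
  then show "seq_L f" using pos a by (simp add: seq_L_def)
  show "seq_D f" if D: "seq_D w"
  proof -
    obtain K where K: "eventually (\<lambda>n. \<forall>k>0. w (n + k) \<le> K * w n) at_top"
      using D by (auto simp: seq_D_def)
    have "eventually (\<lambda>n. (a / 2) * w n < f n \<and> f n < 2 * a * w n) at_top"
      using two wpos by eventually_elim (simp add: field_simps)
    then obtain N where N: "\<And>n. n \<ge> N \<Longrightarrow> (a / 2) * w n < f n" "\<And>n. n \<ge> N \<Longrightarrow> f n < 2 * a * w n"
      by (auto simp: eventually_at_top_linorder)
    have "eventually (\<lambda>n. \<forall>k>0. f (n + k) \<le> (4 * max K 0) * f n) at_top"
      using K eventually_ge_at_top[of N] wpos
    proof eventually_elim
      case (elim n)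
      show ?case
      proof (intro allI impI)
        fix k :: int assume k: "k > 0"
        have "f (n + k) \<le> 2 * a * w (n + k)" using N(2)[of "n + k"] elim k by simp
        also have "\<dots> \<le> 2 * a * (max K 0 * w n)"
        proof (intro mult_left_mono)
          have "w (n + k) \<le> K * w n" using elim k by auto
          also have "\<dots> \<le> max K 0 * w n" using elim by (intro mult_right_mono) auto
          finally show "w (n + k) \<le> max K 0 * w n" .
        qed (use a in simp)
        also have "\<dots> = 4 * max K 0 * (a / 2 * w n)" by simp
        also have "\<dots> \<le> 4 * max K 0 * f n"
          using N(1)[of n] elim by (intro mult_left_mono) auto
        finally show "f (n + k) \<le> 4 * max K 0 * f n" .
      qed
    qed
    then show ?thesis by (auto simp: seq_D_def)
  qed
qed

context subexp_weight
begin

lemma seq_L_w: "seq_L w"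
  using w_pos w_long by (simp add: seq_L_def)

text \<open>
  By \<open>ratio_lim_conv\<close> the sequence \<open>f * f\<close> has ratio limit \<open>2 * a\<close>.
\<close>
lemma seq_S_ratio_lim:
  assumes f: "ratio_lim f a" and a: "a > 0" and s: "infsum f UNIV = 1"
  shows "seq_S f"
proof -
  have lim: "((\<lambda>n. f n / w n) \<longlongrightarrow> a) at_top" using f by (simp add: ratio_lim_def)
  have "((\<lambda>n. conv f f n / w n) \<longlongrightarrow> 2 * a) at_top"
    using ratio_lim_conv[OF f f] s by (simp add: ratio_lim_def)
  then have "((\<lambda>n. (conv f f n / w n) / (f n / w n)) \<longlongrightarrow> 2 * a / a) at_top"
    using a lim by (intro tendsto_divide) auto
  moreover have "eventually (\<lambda>n. (conv f f n / w n) / (f n / w n) = conv f f n / f n) at_top"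
    using w_pos by eventually_elim simp
  ultimately have "((\<lambda>n. conv f f n / f n) \<longlongrightarrow> 2 * a / a) at_top"
    by (rule Lim_transform_eventually)
  then show ?thesis using a seq_L_equiv[OF seq_L_w lim a] by (simp add: seq_S_def)
qed

lemma ratio_lim_cmult: "ratio_lim f a \<Longrightarrow> ratio_lim (\<lambda>n. c * f n) (c * a)"
  using tendsto_mult_left[of "\<lambda>n. f n / w n" a at_top c]
  by (auto simp: ratio_lim_def supported_def intro: summable_on_cmult_right)

lemma ratio_lim_add: "ratio_lim f a \<Longrightarrow> ratio_lim h b \<Longrightarrow> ratio_lim (\<lambda>n. f n + h n) (a + b)"
  using tendsto_add[of "\<lambda>n. f n / w n" a at_top "\<lambda>n. h n / w n" b]
  by (auto simp: ratio_lim_def supported_def add_divide_distrib intro: summable_on_add)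

lemma ratio_lim_finite:
  assumes "finite S" "\<And>n. n \<notin> S \<Longrightarrow> f n = 0" "supported f"
  shows "ratio_lim f 0"
proof -
  obtain M where M: "S \<subseteq> {..M}" using bounded_above_finite[OF assms(1)] .
  have "eventually (\<lambda>n. f n / w n = 0) at_top"
    using eventually_gt_at_top[of M] by eventually_elim (use M assms(2) in force)
  moreover have "ell1 f"
    using summable_on_cong_neutral[of UNIV S f f] assms by auto
  ultimately show ?thesis using assms by (simp add: ratio_lim_def tendsto_eventually)
qed

end

section \<open>Convolution exponentials and the passage from G to its compound Poisson law\<close>
definition exp_seq :: "(int \<Rightarrow> real) \<Rightarrow> int \<Rightarrow> real" where
  "exp_seq f = power_series (\<lambda>k. inverse (fact k)) f"

lemma summable_inverse_fact: "summable (\<lambda>k. \<bar>inverse (fact k)\<bar> * x ^ k)" for x :: real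
  using summable_exp[of x] by (simp add: divide_inverse mult.commute)

lemma ell1_exp_seq: "ell1 f \<Longrightarrow> ell1 (exp_seq f)"
  unfolding exp_seq_def by (rule ell1_power_series[OF _ summable_inverse_fact])

lemma fourier_exp_seq:
  assumes "ell1 f"
  shows "fourier (exp_seq f) t = exp (fourier f t)"
proof -
  have "fourier (exp_seq f) t = (\<Sum>k. of_real (inverse (fact k)) * fourier f t ^ k)"
    unfolding exp_seq_def by (rule fourier_power_series[OF assms summable_inverse_fact])
  also have "\<dots> = exp (fourier f t)"
    by (simp add: exp_def scaleR_conv_of_real)
  finally show ?thesis .
qed

lemma infsum_exp_seq: "ell1 f \<Longrightarrow> infsum (exp_seq f) UNIV = exp (infsum f UNIV)"
  using fourier_exp_seq[of f 0] by (simp add: fourier_0 ell1_exp_seq exp_of_real)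

lemma seq_pow_nonneg: "(\<And>n. f n \<ge> 0) \<Longrightarrow> seq_pow f k n \<ge> 0"
  by (induction k arbitrary: n) (auto simp: unit_seq_def conv_def intro!: infsum_nonneg)

text \<open>
  For non-negative sequences the partial sums of the exponential series are lower bounds; in
  particular \<open>exp_seq f\<close> dominates \<open>unit_seq\<close>.
\<close>
lemma exp_seq_partial:
  assumes f: "\<And>n. f n \<ge> 0" "ell1 f"
  shows "(\<Sum>k<K. seq_pow f k n / fact k) \<le> exp_seq f n"
proof -
  have "(\<Sum>k<K. inverse (fact k) * seq_pow f k n) \<le> exp_seq f n"
    unfolding exp_seq_def power_series_def
    using power_series_summable(2)[OF f(2) summable_inverse_fact, of n] f
    by (intro sum_le_suminf) (auto intro!: mult_nonneg_nonneg seq_pow_nonneg)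
  then show ?thesis by (simp add: field_simps)
qed

text \<open>
  The exponential series is its own derivative.
\<close>
lemma (in subexp_weight) ratio_lim_exp_seq:
  assumes "ratio_lim f a"
  shows "ratio_lim (exp_seq f) (a * exp (infsum f UNIV))"
proof -
  let ?s = "infsum f UNIV"
  have "(\<lambda>k. inverse (fact (Suc k)) * (of_nat (Suc k) * ?s ^ (Suc k - 1))) sums exp ?s"
    using exp_converges[of ?s] by (simp add: field_simps del: of_nat_Suc)
  then have "(\<lambda>k. inverse (fact k) * (of_nat k * ?s ^ (k - 1))) sums exp ?s"
    using sums_Suc_iff[of "\<lambda>k. inverse (fact k) * (of_nat k * ?s ^ (k - 1))" "exp ?s"] by simp
  then show ?thesis
    using ratio_lim_power_series[OF assms, of "l1 f + 1" "\<lambda>k. inverse (fact k)"] summable_inverse_fact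
    by (simp add: exp_seq_def sums_iff)
qed

definition compound_poisson :: "real \<Rightarrow> (int \<Rightarrow> real) \<Rightarrow> int \<Rightarrow> real" where
  "compound_poisson lam g n = exp (- lam) * exp_seq (\<lambda>j. lam * g j) n"

lemma seq_pow_cmult: "seq_pow (\<lambda>j. c * f j) k n = c ^ k * seq_pow f k n"
  by (induction k arbitrary: n) (auto simp: conv_def infsum_cmult_right' mult_ac simp flip: infsum_cmult_right')

lemma prob_seq_compound_poisson:
  assumes g: "prob_seq g" and lam: "lam \<ge> 0"
  shows "prob_seq (compound_poisson lam g)"
proof -
  note g' = prob_seqD[OF g]
  have l: "ell1 (\<lambda>j. lam * g j)" using g' by (intro summable_on_cmult_right)
  have "exp_seq (\<lambda>j. lam * g j) n \<ge> 0" for n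
    using exp_seq_partial[of "\<lambda>j. lam * g j" n 0] g' lam l by simp
  then show ?thesis
    using ell1_exp_seq[OF l] infsum_exp_seq[OF l] g'(3)
    by (auto simp: prob_seq_def compound_poisson_def[abs_def] infsum_cmult_right' summable_on_cmult_right simp flip: exp_add)
qed

lemma fourier_compound_poisson:
  assumes g: "prob_seq g"
  shows "fourier (compound_poisson lam g) t = exp (of_real lam * (fourier g t - 1))"
proof -
  have "fourier (compound_poisson lam g) t = of_real (exp (- lam)) * exp (of_real lam * fourier g t)"
    using fourier_exp_seq[of "\<lambda>j. lam * g j" t] prob_seqD[OF g]
    by (simp add: compound_poisson_def[abs_def] fourier_cmult summable_on_cmult_right)
  then show ?thesis
    by (simp add: right_diff_distrib exp_diff exp_minus exp_of_real field_simps)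
qed

text \<open>
  The weight is \<open>g\<close> itself, which has ratio limit \<open>1\<close>.
\<close>
lemma compound_poisson_of_seq_S:
  assumes g: "prob_seq g" and lam: "lam > 0" and S: "seq_S g" and I: "admissible_tail I g"
    and supp: "\<And>n. n \<notin> I \<Longrightarrow> g n = 0"
  shows "seq_S (compound_poisson lam g)" "admissible_tail I (compound_poisson lam g)"
    "((\<lambda>n. compound_poisson lam g n / g n) \<longlongrightarrow> lam) at_top"
proof -
  note g' = prob_seqD[OF g]
  interpret subexp_weight g I by (rule seq_S_subexp_weight[OF g S I])
  have "ratio_lim g 1"
    using w_ratio[of 0] g' supp by (simp add: ratio_lim_def supported_def)
  from ratio_lim_exp_seq[OF ratio_lim_cmult[OF this, of lam]]
  have "ratio_lim (exp_seq (\<lambda>j. lam * g j)) (lam * exp lam)"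
    by (simp add: infsum_cmult_right' g')
  from ratio_lim_cmult[OF this, of "exp (- lam)"]
  have A: "ratio_lim (compound_poisson lam g) lam"
    by (simp add: compound_poisson_def[abs_def] mult.left_commute[of _ lam] flip: exp_add)
  then show lim: "((\<lambda>n. compound_poisson lam g n / g n) \<longlongrightarrow> lam) at_top" by (simp add: ratio_lim_def)
  show "seq_S (compound_poisson lam g)"
    using seq_S_ratio_lim[OF A lam] prob_seqD(3)[OF prob_seq_compound_poisson[OF g]] lam by simp
  show "admissible_tail I (compound_poisson lam g)"
    using I seq_D_equiv[OF seq_L_w lim lam] by (auto simp: admissible_tail_def)
qed

section \<open>Recovering subexponentiality from the ratio limit\<close>

text \<open>
  Restricting \<open>g * g\<^sup>k\<close> to bounded first or bounded second argument loses little mass, and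
  long-tailedness evaluates both pieces: the first contributes about \<open>k * g n\<close> by induction and
  the second about \<open>g n\<close>.
\<close>
lemma seq_pow_liminf:
  assumes g: "prob_seq g" and L: "seq_L g" and d: "d > 0"
  shows "eventually (\<lambda>n. (of_nat k - d) * g n \<le> seq_pow g k n) at_top"
  using d
proof (induction k arbitrary: d)
  case 0
  note g' = prob_seqD[OF g]
  have "(of_nat 0 - d) * g n \<le> seq_pow g 0 n" for n
    using 0 g'(1)[of n] seq_pow_nonneg[of g 0 n, OF g'(1)] by (simp add: mult_nonneg_nonneg order_trans[of _ 0])
  then show ?case by simp
next
  case (Suc k)
  note g' = prob_seqD[OF g]
  \<comment> \<open>the losses below add up to \<open>e * (k + 2)\<close>, which must stay under \<open>d\<close>\<close>
  define e where "e = d / (of_nat k + 3)"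
  have e: "e > 0" "e * (of_nat k + 3) = d" using Suc.prems by (auto simp: e_def)
  let ?h = "seq_pow g k"
  have h: "\<And>n. ?h n \<ge> 0" "ell1 ?h" "infsum ?h UNIV = 1"
    using g' by (auto simp: seq_pow_nonneg ell1_seq_pow infsum_seq_pow)
  obtain S where S: "finite S" "sum g S \<ge> 1 - e" "sum g S \<le> 1"
    using nonneg_finite_approx[OF g'(1,2) e(1)] g'(3) by auto
  obtain T where T: "finite T" "sum ?h T \<ge> 1 - e"
    using nonneg_finite_approx[OF h(1,2) e(1)] h(3) by auto
  obtain M where M: "M \<ge> 0" "S \<union> T \<subseteq> {..M}"
    using bounded_above_finite[of "S \<union> T"] S T by auto
  have IH: "eventually (\<lambda>n. \<forall>j\<in>S. (of_nat k - e) * g (n - j) \<le> ?h (n - j)) at_top"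
    using eventually_int_shift[OF Suc.IH[OF e(1)]]
    by (intro eventually_ball_finite S ballI) (metis (no_types, lifting) diff_conv_add_uminus eventually_mono)
  have "((\<lambda>n. (of_nat k - e) * ((\<Sum>j\<in>S. g j * g (n - j)) / g n) + (\<Sum>j\<in>T. ?h j * g (n - j)) / g n)
      \<longlongrightarrow> (of_nat k - e) * sum g S + sum ?h T) at_top"
    by (intro tendsto_intros finite_sum_shift_tendsto L S T)
  moreover have "of_nat (Suc k) - d < (of_nat k - e) * sum g S + sum ?h T"
  proof -
    have "real k * (1 - e) \<le> real k * sum g S" using S by (intro mult_left_mono) auto
    moreover have "e * sum g S \<le> e * 1" using S e by (intro mult_left_mono) auto
    ultimately have "real k * (1 - e) - e + (1 - e) \<le> (of_nat k - e) * sum g S + sum ?h T"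
      using T by (simp add: left_diff_distrib)
    moreover have "of_nat (Suc k) - d < real k * (1 - e) - e + (1 - e)"
      using e by (simp add: algebra_simps flip: e(2))
    ultimately show ?thesis by linarith
  qed
  ultimately have "eventually (\<lambda>n. of_nat (Suc k) - d <
      (of_nat k - e) * ((\<Sum>j\<in>S. g j * g (n - j)) / g n) + (\<Sum>j\<in>T. ?h j * g (n - j)) / g n) at_top"
    by (rule order_tendstoD(1))
  moreover have "eventually (\<lambda>n. g n > 0) at_top" using L by (simp add: seq_L_def)
  ultimately show ?case
    using IH eventually_gt_at_top[of "2 * M"]
  proof eventually_elim
    case (elim n)
    have "(of_nat (Suc k) - d) * g n \<le> (of_nat k - e) * (\<Sum>j\<in>S. g j * g (n - j)) + (\<Sum>j\<in>T. ?h j * g (n - j))"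
      using elim by (simp add: field_simps)
    also have "(of_nat k - e) * (\<Sum>j\<in>S. g j * g (n - j)) = (\<Sum>j\<in>S. g j * ((of_nat k - e) * g (n - j)))"
      by (simp add: sum_distrib_left mult_ac)
    also have "\<dots> \<le> (\<Sum>j\<in>S. g j * ?h (n - j))"
      using elim g' by (intro sum_mono mult_left_mono) auto
    also have "(\<Sum>j\<in>S. g j * ?h (n - j)) + (\<Sum>j\<in>T. ?h j * g (n - j)) \<le> seq_pow g (Suc k) n"
    proof -
      have "(\<Sum>j\<in>{M<..<n - M}. g j * ?h (n - j)) \<ge> 0"
        using g' h by (intro sum_nonneg mult_nonneg_nonneg) auto
      then show ?thesis
        using conv_ge_finite_parts[OF g'(1,2) h(1,2) S(1) _ T(1) _ elim(4)] M by simp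
    qed
    finally show ?case by simp
  qed
qed

lemma conv_unit: "conv f unit_seq = f"
proof
  fix n
  have "conv f unit_seq n = (\<Sum>\<^sub>\<infinity>j\<in>{n}. f j * unit_seq (n - j))"
    unfolding conv_def by (rule infsum_cong_neutral) (auto simp: unit_seq_def)
  then show "conv f unit_seq n = f n" by (simp add: unit_seq_def)
qed

text \<open>
  The quotient \<open>p n / g n\<close> is the sum of \<open>c\<^sub>k * (g\<^sup>k n / g n)\<close> with Poisson weights \<open>c\<^sub>k\<close>. Inserting the
  lower bounds \<open>k\<close> for all exponents but \<open>2\<close>, and using that \<open>\<Sum>\<^sub>k k * c\<^sub>k = lam\<close> is the limit of the
  quotient, leaves \<open>2\<close> as an upper bound for the limsup of \<open>g\<^sup>2 n / g n\<close>.
\<close>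
lemma seq_S_of_compound_poisson_ratio:
  assumes g: "prob_seq g" and lam: "lam > 0" and L: "seq_L g"
    and lim: "((\<lambda>n. compound_poisson lam g n / g n) \<longlongrightarrow> lam) at_top"
  shows "seq_S g"
proof -
  note g' = prob_seqD[OF g]
  define c where "c k = exp (- lam) * (lam ^ k / fact k)" for k :: nat
  have c: "c k > 0" for k using lam by (simp add: c_def)
  have gpos: "eventually (\<lambda>n. g n > 0) at_top" using L by (simp add: seq_L_def)
  have pw2: "conv g g = seq_pow g 2"
    by (simp add: numeral_2_eq_2 conv_unit)
  have partial: "(\<Sum>k<K. c k * seq_pow g k n) \<le> compound_poisson lam g n" for K n
  proof -
    have "(\<Sum>k<K. seq_pow (\<lambda>j. lam * g j) k n / fact k) \<le> exp_seq (\<lambda>j. lam * g j) n"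
      using g' lam by (intro exp_seq_partial summable_on_cmult_right) auto
    then have "exp (- lam) * (\<Sum>k<K. seq_pow (\<lambda>j. lam * g j) k n / fact k) \<le> compound_poisson lam g n"
      unfolding compound_poisson_def by (intro mult_left_mono) auto
    then show ?thesis by (simp add: c_def seq_pow_cmult sum_distrib_left mult_ac)
  qed
  have "(\<lambda>k. c (Suc k) * of_nat (Suc k)) sums (exp (- lam) * lam * exp lam)"
  proof -
    have "(\<lambda>k. exp (- lam) * lam * (inverse (fact k) *\<^sub>R lam ^ k)) sums (exp (- lam) * lam * exp lam)"
      by (intro sums_mult exp_converges)
    then show ?thesis by (simp add: c_def field_simps del: of_nat_Suc)
  qed
  moreover have "exp (- lam) * lam * exp lam = lam" by (simp add: exp_minus)
  ultimately have csums: "(\<lambda>k. c k * of_nat k) sums lam"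
    using sums_Suc_iff[of "\<lambda>k. c k * of_nat k" lam]
    by (simp del: of_nat_Suc)
  have csum1: "(\<Sum>k<K. c k) \<le> 1" for K
  proof -
    have "(\<lambda>k. exp (- lam) * (inverse (fact k) *\<^sub>R lam ^ k)) sums (exp (- lam) * exp lam)"
      by (intro sums_mult exp_converges)
    then have "c sums 1" by (simp add: c_def[abs_def] field_simps flip: exp_add)
    then show ?thesis using sum_le_suminf[of c "{..<K}"] c by (auto simp: sums_iff less_imp_le)
  qed
  have "((\<lambda>n. conv g g n / g n) \<longlongrightarrow> 2) at_top"
  proof (rule order_tendstoI)
    fix a :: real assume a: "a < 2"
    have "eventually (\<lambda>n. (of_nat 2 - (2 - a) / 2) * g n \<le> seq_pow g 2 n) at_top"
      using a by (intro seq_pow_liminf g L) auto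
    with gpos show "eventually (\<lambda>n. a < conv g g n / g n) at_top"
    proof eventually_elim
      case (elim n)
      have "a * g n < (of_nat 2 - (2 - a) / 2) * g n"
        using a elim by (intro mult_strict_right_mono) (simp_all add: field_simps)
      also note elim(2)
      finally show ?case using elim by (simp add: pw2 pos_less_divide_eq del: seq_pow.simps)
    qed
  next
    fix a :: real assume a: "a > 2"
    \<comment> \<open>the errors will add up to \<open>3 * d\<close>, while the excess \<open>(a - 2) * c 2\<close> is \<open>4 * d\<close>\<close>
    define d where "d = (a - 2) * c 2 / 4"
    have d: "d > 0" using a c[of 2] by (simp add: d_def)
    have "eventually (\<lambda>K. (\<Sum>k<K. c k * of_nat k) > lam - d) sequentially"
      using csums d by (intro order_tendstoD(1)[of _ lam]) (auto simp: sums_def)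
    with eventually_gt_at_top[of 2]
    have "eventually (\<lambda>K. K > 2 \<and> (\<Sum>k<K. c k * of_nat k) > lam - d) sequentially"
      by eventually_elim simp
    then obtain K where K: "K > 2" "(\<Sum>k<K. c k * of_nat k) > lam - d"
      using eventually_happens[of _ "sequentially"] by auto
    have "eventually (\<lambda>n. \<forall>k\<in>{..<K}. (of_nat k - d) * g n \<le> seq_pow g k n) at_top"
      by (intro eventually_ball_finite ballI seq_pow_liminf g L d) auto
    moreover have "eventually (\<lambda>n. compound_poisson lam g n / g n < lam + d) at_top"
      using d by (intro order_tendstoD(2)[OF lim]) auto
    ultimately show "eventually (\<lambda>n. conv g g n / g n < a) at_top"
      using gpos
    proof eventually_elim
      case (elim n)
      have two: "(2::nat) \<in> {..<K}" using K by auto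
      have "c 2 * seq_pow g 2 n + (\<Sum>k\<in>{..<K} - {2}. c k * ((of_nat k - d) * g n)) \<le>
         c 2 * seq_pow g 2 n + (\<Sum>k\<in>{..<K} - {2}. c k * seq_pow g k n)"
        using elim c by (intro add_left_mono sum_mono mult_left_mono) (auto simp: less_imp_le)
      also have "\<dots> = (\<Sum>k<K. c k * seq_pow g k n)"
        by (rule sum.remove[OF _ two, symmetric]) simp
      also have "\<dots> \<le> compound_poisson lam g n" by (rule partial)
      also have "\<dots> \<le> (lam + d) * g n" using elim by (simp add: field_simps)
      finally have 1: "c 2 * seq_pow g 2 n + (\<Sum>k\<in>{..<K} - {2}. c k * ((of_nat k - d) * g n)) \<le> (lam + d) * g n" .
      have "(\<Sum>k\<in>{..<K} - {2}. c k * ((of_nat k - d) * g n)) =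
          (\<Sum>k\<in>{..<K} - {2}. c k * (of_nat k - d)) * g n"
        by (simp add: sum_distrib_right mult.assoc)
      also have "(\<Sum>k\<in>{..<K} - {2}. c k * (of_nat k - d)) = (\<Sum>k<K. c k * (of_nat k - d)) - c 2 * (2 - d)"
        using sum.remove[OF _ two, of "\<lambda>k. c k * (of_nat k - d)"] by simp
      also have "(\<Sum>k<K. c k * (of_nat k - d)) = (\<Sum>k<K. c k * of_nat k) - (\<Sum>k<K. c k) * d"
        by (simp add: right_diff_distrib sum_subtractf sum_distrib_right)
      finally have 2: "(\<Sum>k\<in>{..<K} - {2}. c k * ((of_nat k - d) * g n)) =
         ((\<Sum>k<K. c k * of_nat k) - (\<Sum>k<K. c k) * d - c 2 * (2 - d)) * g n" .
      have "(\<Sum>k<K. c k) * d \<le> 1 * d" using csum1 d by (intro mult_right_mono) auto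
      then have "(\<Sum>k<K. c k * of_nat k) - (\<Sum>k<K. c k) * d - c 2 * (2 - d) \<ge> lam - 2 * d - c 2 * 2"
        using K(2) mult_nonneg_nonneg[OF less_imp_le[OF c[of 2]] less_imp_le[OF d]]
        unfolding right_diff_distrib by linarith
      from mult_right_mono[OF this, of "g n"] elim
      have 3: "(lam - 2 * d - c 2 * 2) * g n \<le> (\<Sum>k\<in>{..<K} - {2}. c k * ((of_nat k - d) * g n))"
        unfolding 2 by simp
      have "c 2 * seq_pow g 2 n \<le> (lam + d) * g n - (lam - 2 * d - c 2 * 2) * g n" using 1 3 by linarith
      also have "\<dots> = (c 2 * 2 + 3 * d) * g n" by (simp add: algebra_simps)
      also have "\<dots> < (c 2 * a) * g n"
      proof (intro mult_strict_right_mono)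
        have "c 2 * a = c 2 * 2 + 4 * d" by (simp add: d_def field_simps)
        then show "c 2 * 2 + 3 * d < c 2 * a" using d by simp
      qed (use elim in auto)
      finally have "c 2 * seq_pow g 2 n < c 2 * (a * g n)" by (simp add: mult.assoc)
      then have "seq_pow g 2 n < a * g n" using c[of 2] by simp
      then show ?case using elim by (simp add: pw2 field_simps del: seq_pow.simps)
    qed
  qed
  then show ?thesis using L by (simp add: seq_S_def)
qed

section \<open>Convolution logarithms and the passage from the compound Poisson law to G\<close>
lemma (in subexp_weight) supported_exp_seq: "supported f \<Longrightarrow> supported (exp_seq f)"
  using supported_seq_pow[of f] by (auto simp: supported_def exp_seq_def power_series_def)

text \<open>
  The Taylor coefficients of \<open>ln (1 + z)\<close>. At \<open>k = 0\<close> the division by zero gives the value \<open>0\<close> that is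
  wanted there.
\<close>
definition log_coeff :: "nat \<Rightarrow> real" where
  "log_coeff k = - ((- 1) ^ k / of_nat k)"

lemma summable_log_coeff:
  assumes "0 \<le> r" "r < (1::real)"
  shows "summable (\<lambda>k. \<bar>log_coeff k\<bar> * r ^ k)"
proof (rule summable_comparison_test'[of "\<lambda>k. r ^ k" 0])
  show "summable (\<lambda>k. r ^ k)" using assms by (simp add: summable_geometric)
  fix k :: nat
  have "\<bar>log_coeff k\<bar> \<le> 1"
    by (cases "k = 0") (auto simp: log_coeff_def power_abs)
  then have "\<bar>log_coeff k\<bar> * r ^ k \<le> 1 * r ^ k"
    using assms by (intro mult_right_mono) auto
  then show "norm (\<bar>log_coeff k\<bar> * r ^ k) \<le> r ^ k"
    using assms by simp
qed

text \<open>
  For a non-negative \<open>f\<close> of norm at most \<open>1 / 4\<close>, the sequence \<open>u\<close> is non-negative, so its norm is its sum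
  \<open>exp (\<Sum>f) - 1\<close>, which is below the radius of convergence. The transform of \<open>f\<close> is then small
  enough to lie on the principal branch of the logarithm.
\<close>
lemma power_series_log_exp:
  assumes f: "ell1 f" "\<And>n. f n \<ge> 0" and small: "infsum f UNIV \<le> 1 / 4"
  defines "u \<equiv> \<lambda>n. exp_seq f n - unit_seq n"
  shows "ell1 u" "infsum u UNIV = exp (infsum f UNIV) - 1" "l1 u \<le> 1 / 2" "power_series log_coeff u = f"
proof -
  have u: "u = (\<lambda>n. exp_seq f n + (- 1) * unit_seq n)" by (simp add: u_def fun_eq_iff)
  have m: "ell1 (\<lambda>n. (- 1) * unit_seq n)" by (intro summable_on_cmult_right) simp
  show eu: "ell1 u"
    unfolding u by (intro summable_on_add ell1_exp_seq f m)
  show su: "infsum u UNIV = exp (infsum f UNIV) - 1"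
    by (simp only: u infsum_add[OF ell1_exp_seq[OF f(1)] m] infsum_exp_seq[OF f(1)]
        infsum_cmult_right' infsum_unit)
  have "u n \<ge> 0" for n
    using exp_seq_partial[of f n 1] f by (simp add: u_def)
  then have "l1 u = infsum u UNIV" by (simp add: l1_def)
  moreover have s0: "infsum f UNIV \<ge> 0" by (simp add: infsum_nonneg f)
  moreover have "exp (infsum f UNIV) \<le> 1 + infsum f UNIV + (infsum f UNIV)\<^sup>2"
    using s0 small by (intro exp_bound) auto
  moreover have "(infsum f UNIV)\<^sup>2 \<le> (1 / 4)\<^sup>2"
    using s0 small by (intro power_mono) auto
  ultimately show l1u: "l1 u \<le> 1 / 2"
    using small su by (simp add: power2_eq_square)
  have c: "summable (\<lambda>k. \<bar>log_coeff k\<bar> * l1 u ^ k)"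
    by (rule summable_log_coeff) (use l1u in auto)
  show "power_series log_coeff u = f"
  proof (rule fourier_inject[OF ell1_power_series[OF eu c] f(1)])
    fix t
    have "norm (fourier u t) < 1" using norm_fourier_le[OF eu, of t] l1u by simp
    from Ln_series'[OF this]
    have "(\<lambda>n. of_real (log_coeff n) * fourier u t ^ n) sums ln (1 + fourier u t)"
      by (simp add: log_coeff_def power_minus[of "fourier u t"])
    moreover have "1 + fourier u t = exp (fourier f t)"
      by (simp only: u fourier_add[OF ell1_exp_seq[OF f(1)] m] fourier_cmult fourier_unit fourier_exp_seq[OF f(1)]) simp
    moreover have "ln (exp (fourier f t)) = fourier f t"
    proof -
      have "l1 f = infsum f UNIV" by (simp add: l1_def f)
      then have "\<bar>Im (fourier f t)\<bar> \<le> 1 / 4"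
        using abs_Im_le_cmod[of "fourier f t"] norm_fourier_le[OF f(1), of t] small by linarith
      then show ?thesis using pi_gt3 by (intro Ln_exp) auto
    qed
    ultimately show "fourier (power_series log_coeff u) t = fourier f t"
      using fourier_power_series[OF eu c, of t] by (simp add: sums_iff)
  qed
qed

text \<open>
  The derivative of \<open>ln (1 + z)\<close> at \<open>\<Sum>u = exp (\<Sum>f) - 1\<close> is \<open>exp (- \<Sum>f)\<close>.
\<close>
lemma (in subexp_weight) ratio_lim_log:
  assumes f: "ell1 f" "\<And>n. f n \<ge> 0" and small: "infsum f UNIV \<le> 1 / 4"
    and a: "ratio_lim (exp_seq f) a"
  shows "ratio_lim f (a * exp (- infsum f UNIV))"
proof -
  define u where "u = (\<lambda>n. exp_seq f n - unit_seq n)"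
  note U = power_series_log_exp[OF f small, folded u_def]
  let ?s = "infsum u UNIV"
  have "ratio_lim u (a + (- 1) * 0)"
    using ratio_lim_add[OF a ratio_lim_cmult[OF ratio_lim_unit, of "- 1"]] by (simp add: u_def)
  then have au: "ratio_lim u a" by simp
  have s: "\<bar>?s\<bar> < 1" using abs_infsum_le_l1[OF U(1)] U(3) by linarith
  have "(\<lambda>k. (- ?s) ^ k) sums (1 / (1 - (- ?s)))"
    using s by (intro geometric_sums) auto
  also have "(\<lambda>k. (- ?s) ^ k) = (\<lambda>k. log_coeff (Suc k) * (of_nat (Suc k) * ?s ^ (Suc k - 1)))"
    by (simp add: log_coeff_def fun_eq_iff power_minus[of ?s] del: of_nat_Suc)
  finally have "(\<lambda>k. log_coeff k * (of_nat k * ?s ^ (k - 1))) sums (1 / (1 + ?s))"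
    using sums_Suc_iff[of "\<lambda>k. log_coeff k * (of_nat k * ?s ^ (k - 1))" "1 / (1 + ?s)"] by simp
  then have "ratio_lim (power_series log_coeff u) (a * (1 / (1 + ?s)))"
    using ratio_lim_power_series[OF au, of "3 / 4" log_coeff] U(3) summable_log_coeff[of "3 / 4"]
    by (simp add: sums_iff)
  then show ?thesis
    by (simp add: U(2,4) exp_minus field_simps)
qed

text \<open>
  The logarithmic series cannot be applied to \<open>p\<close> directly, since \<open>exp (lam * g)\<close> may be far from the
  unit. Removing finitely many masses of \<open>g\<close>, which amounts to convolving with an exponential of
  ratio limit \<open>0\<close>, leaves an exponential within reach of the series.
\<close>
lemma seq_S_of_compound_poisson:
  assumes g: "prob_seq g" and lam: "lam > 0" and S: "seq_S (compound_poisson lam g)"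
    and I: "admissible_tail I (compound_poisson lam g)" and supp: "\<And>n. n \<notin> I \<Longrightarrow> g n = 0"
  shows "seq_S g" "admissible_tail I g"
proof -
  note g' = prob_seqD[OF g]
  let ?p = "compound_poisson lam g"
  have p: "prob_seq ?p" using prob_seq_compound_poisson[OF g] lam by simp
  interpret subexp_weight ?p I by (rule seq_S_subexp_weight[OF p S I])
  have "supported (exp_seq (\<lambda>j. lam * g j))"
    using supp by (intro supported_exp_seq) (auto simp: supported_def)
  then have "supported ?p" by (auto simp: supported_def compound_poisson_def)
  then have p1: "ratio_lim ?p 1"
    using w_ratio[of 0] prob_seqD[OF p] by (simp add: ratio_lim_def)
  \<comment> \<open>outside \<open>T\<close> the sequence \<open>lam * g\<close> has sum at most \<open>1 / 4\<close>, as the logarithm requires\<close>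
  obtain T where T: "finite T" "sum g T \<ge> 1 - 1 / (4 * lam)"
    using nonneg_finite_approx[OF g'(1,2), of "1 / (4 * lam)"] g'(3) lam by auto
  define f1 where "f1 n = (if n \<in> T then - lam * g n else 0)" for n
  define f2 where "f2 n = (if n \<in> T then 0 else lam * g n)" for n
  have f1: "ratio_lim f1 0"
    using supp by (intro ratio_lim_finite[OF T(1)]) (auto simp: f1_def supported_def)
  have f1': "ell1 f1" using f1 by (simp add: ratio_lim_def)
  have lg: "ell1 (\<lambda>n. lam * g n)" by (intro summable_on_cmult_right g')
  have f2_eq: "f2 = (\<lambda>n. lam * g n + f1 n)" by (auto simp: f1_def f2_def)
  have f2: "ell1 f2" "\<And>n. f2 n \<ge> 0"
    using summable_on_add[OF lg f1'] g' lam by (simp_all add: f2_eq[symmetric]) (simp add: f2_def)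
  have "infsum f1 UNIV = infsum (\<lambda>n. - lam * g n) T"
    by (rule infsum_cong_neutral) (auto simp: f1_def)
  also have "\<dots> = - lam * sum g T" using T(1) by (simp add: sum_distrib_left)
  finally have s1: "infsum f1 UNIV = - lam * sum g T" .
  have s2: "infsum f2 UNIV = lam + infsum f1 UNIV"
    unfolding f2_eq by (subst infsum_add[OF lg f1']) (simp add: infsum_cmult_right' g')
  have small: "infsum f2 UNIV \<le> 1 / 4"
    using mult_left_mono[OF T(2), of lam] lam unfolding s2 s1 by (simp add: right_diff_distrib)
  have e1: "ratio_lim (exp_seq f1) 0" using ratio_lim_exp_seq[OF f1] by simp
  have e1': "ell1 (exp_seq f1)" using e1 by (simp add: ratio_lim_def)
  have q: "exp_seq f2 = (\<lambda>n. exp lam * conv (exp_seq f1) ?p n)"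
  proof (rule fourier_inject)
    show "ell1 (exp_seq f2)" by (rule ell1_exp_seq[OF f2(1)])
    show "ell1 (\<lambda>n. exp lam * conv (exp_seq f1) ?p n)"
      by (intro summable_on_cmult_right ell1_conv e1' prob_seqD[OF p])
    fix t
    have "fourier f2 t = of_real lam * fourier g t + fourier f1 t"
      unfolding f2_eq by (simp only: fourier_add[OF lg f1'] fourier_cmult)
    then show "fourier (exp_seq f2) t = fourier (\<lambda>n. exp lam * conv (exp_seq f1) ?p n) t"
      using prob_seqD(2)[OF p]
      by (simp add: fourier_exp_seq f2 f1' e1' fourier_cmult fourier_conv fourier_compound_poisson[OF g]
          right_diff_distrib exp_of_real[symmetric] add.commute[of "fourier f1 t"] flip: exp_add)
  qed
  have "ratio_lim (exp_seq f2) (exp lam * exp (infsum f1 UNIV))"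
    unfolding q using ratio_lim_cmult[OF ratio_lim_conv[OF e1 p1], of "exp lam"] infsum_exp_seq[OF f1'] by simp
  from ratio_lim_log[OF f2 small this]
  have "ratio_lim f2 1" by (simp add: s2 flip: exp_add)
  from ratio_lim_cmult[OF ratio_lim_add[OF this ratio_lim_cmult[OF f1, of "- 1"]], of "1 / lam"]
  have ag: "ratio_lim g (1 / lam)" using lam by (simp add: f2_eq)
  show "seq_S g" using seq_S_ratio_lim[OF ag _ g'(3)] lam by simp
  have "((\<lambda>n. g n / ?p n) \<longlongrightarrow> 1 / lam) at_top" using ag by (simp add: ratio_lim_def)
  then show "admissible_tail I g"
    using I seq_D_equiv[OF seq_L_w] lam by (auto simp: admissible_tail_def)
qed

section \<open>The local classes of lattice distributions\<close>
lemma seq_L_shift: "seq_L f \<Longrightarrow> seq_L (\<lambda>n. f (n - m))"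
  using eventually_int_shift[of "\<lambda>n. f n > 0" "- m"]
    tendsto_int_shift[of "\<lambda>n. f (n + 1) / f n" 1 "- m"]
  by (simp add: seq_L_def algebra_simps)

lemma seq_D_shift:
  assumes "seq_D f"
  shows "seq_D (\<lambda>n. f (n - m))"
proof -
  obtain K where "eventually (\<lambda>n. \<forall>k>0. f (n + k) \<le> K * f n) at_top"
    using assms by (auto simp: seq_D_def)
  from eventually_int_shift[OF this, of "- m"]
  have "eventually (\<lambda>n. \<forall>k>0. f (n + k - m) \<le> K * f (n - m)) at_top"
    by eventually_elim (simp add: algebra_simps)
  then show ?thesis by (auto simp: seq_D_def)
qed

lemma conv_shift: "conv (\<lambda>n. f (n - m)) (\<lambda>n. f (n - m)) n = conv f f (n - 2 * m)"
proof -
  have b: "bij_betw (\<lambda>j. j - m) UNIV (UNIV :: int set)"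
    by (rule bij_betwI[where g = "\<lambda>j. j + m"]) auto
  show ?thesis
    unfolding conv_def
    using infsum_reindex_bij_betw[OF b, of "\<lambda>j. f j * f (n - 2 * m - j)"]
    by (simp add: algebra_simps)
qed

lemma seq_S_shift:
  assumes "seq_S f"
  shows "seq_S (\<lambda>n. f (n - m))"
proof -
  have L: "seq_L f" and S: "((\<lambda>n. conv f f n / f n) \<longlongrightarrow> 2) at_top"
    using assms by (auto simp: seq_S_def)
  have pos: "eventually (\<lambda>n. f n > 0) at_top" using L by (simp add: seq_L_def)
  have "((\<lambda>n. f (n + (- m)) / f n) \<longlongrightarrow> 1) at_top"
    by (rule long_tail_ratio) (use L in \<open>auto simp: seq_L_def\<close>)
  from tendsto_mult[OF tendsto_int_shift[OF S, of "- 2 * m"] tendsto_int_shift[OF this, of "- m"]]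
  have "((\<lambda>n. conv f f (n + - 2 * m) / f (n + - 2 * m) * (f (n + - m + - m) / f (n + - m))) \<longlongrightarrow> 2) at_top"
    by simp
  moreover have "eventually (\<lambda>n. conv f f (n + - 2 * m) / f (n + - 2 * m) * (f (n + - m + - m) / f (n + - m))
      = conv (\<lambda>n. f (n - m)) (\<lambda>n. f (n - m)) n / f (n - m)) at_top"
    using eventually_int_shift[OF pos, of "- 2 * m"]
    by eventually_elim (simp add: conv_shift algebra_simps)
  ultimately have "((\<lambda>n. conv (\<lambda>n. f (n - m)) (\<lambda>n. f (n - m)) n / f (n - m)) \<longlongrightarrow> 2) at_top"
    by (rule Lim_transform_eventually)
  then show ?thesis using seq_L_shift[OF L] by (simp add: seq_S_def)
qed

lemma
  shows seq_S_shift_iff: "seq_S (\<lambda>n. f (n - m)) \<longleftrightarrow> seq_S f"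
    and seq_D_shift_iff: "seq_D (\<lambda>n. f (n - m)) \<longleftrightarrow> seq_D f"
  using seq_S_shift[of f m] seq_S_shift[of "\<lambda>n. f (n - m)" "- m"]
    seq_D_shift[of f m] seq_D_shift[of "\<lambda>n. f (n - m)" "- m"] by auto

lemma shift_ratio_tendsto_iff:
  fixes p g :: "int \<Rightarrow> real"
  assumes L: "seq_L g"
  shows "((\<lambda>n. p (n - m) / g n) \<longlongrightarrow> a) at_top \<longleftrightarrow> ((\<lambda>n. p n / g n) \<longlongrightarrow> a) at_top"
proof -
  have pos: "eventually (\<lambda>n. g n > 0) at_top" using L by (simp add: seq_L_def)
  have R: "((\<lambda>n. g (n + k) / g n) \<longlongrightarrow> 1) at_top" for k
    by (rule long_tail_ratio) (use L in \<open>auto simp: seq_L_def\<close>)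
  have main: "((\<lambda>n. q (n + k) / g n) \<longlongrightarrow> a) at_top" if "((\<lambda>n. q n / g n) \<longlongrightarrow> a) at_top" for q k
  proof -
    from tendsto_mult[OF tendsto_int_shift[OF that, of k] R[of k]]
    have "((\<lambda>n. q (n + k) / g (n + k) * (g (n + k) / g n)) \<longlongrightarrow> a) at_top" by simp
    moreover have "eventually (\<lambda>n. q (n + k) / g (n + k) * (g (n + k) / g n) = q (n + k) / g n) at_top"
      using eventually_int_shift[OF pos, of k] by eventually_elim simp
    ultimately show ?thesis by (rule Lim_transform_eventually)
  qed
  show ?thesis
    using main[of p "- m"] main[of "\<lambda>n. p (n - m)" m] by auto
qed

definition lattice_dist :: "real measure \<Rightarrow> bool" where
  "lattice_dist F \<longleftrightarrow> real_distribution F \<and> (AE x in F. x \<in> \<int>)"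

lemma prob_seq_mass: "lattice_dist F \<Longrightarrow> prob_seq (mass F)"
  by (auto simp: lattice_dist_def prob_seq_def ell1_mass infsum_mass)

lemma local_prob_lattice:
  assumes F: "lattice_dist F"
  shows "local_prob 1 F x = mass F (\<lfloor>x\<rfloor> + 1)"
proof -
  interpret real_distribution F using F by (simp add: lattice_dist_def)
  show ?thesis
    unfolding local_prob_def mass_def
  proof (rule measure_eq_AE)
    have "AE y in F. y \<in> \<int>" using F by (simp add: lattice_dist_def)
    then show "AE y in F. y \<in> {x<..x + 1} \<longleftrightarrow> y \<in> {real_of_int (\<lfloor>x\<rfloor> + 1)}"
    proof eventually_elim
      case (elim y)
      then obtain k where k: "y = of_int k" by (auto elim: Ints_cases)
      have "x < of_int k \<and> of_int k \<le> x + 1 \<longleftrightarrow> k = \<lfloor>x\<rfloor> + 1"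
        by linarith
      then show ?case by (simp only: k greaterThanAtMost_iff singleton_iff of_int_eq_iff)
    qed
  qed auto
qed

text \<open>
  This carries every asymptotic statement in a real variable \<open>x\<close> about a function of \<open>\<lfloor>x\<rfloor> + 1\<close> over to
  one in an integer variable.
\<close>
lemma filtermap_floor: "filtermap (\<lambda>x::real. \<lfloor>x\<rfloor> + 1) at_top = at_top"
proof (rule filter_eqI)
  fix P :: "int \<Rightarrow> bool"
  show "eventually P (filtermap (\<lambda>x::real. \<lfloor>x\<rfloor> + 1) at_top) \<longleftrightarrow> eventually P at_top"
    unfolding eventually_filtermap eventually_at_top_linorder
  proof
    assume "\<exists>N. \<forall>n\<ge>N. P (\<lfloor>n::real\<rfloor> + 1)"
    then obtain N where N: "\<And>x. x \<ge> N \<Longrightarrow> P (\<lfloor>x::real\<rfloor> + 1)" by auto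
    have "P n" if "n \<ge> \<lceil>N\<rceil> + 1" for n
      using N[of "of_int (n - 1)"] that by (simp add: le_diff_eq ceiling_le_iff) linarith
    then show "\<exists>N. \<forall>n\<ge>N. P n" by blast
  next
    assume "\<exists>N. \<forall>n\<ge>N. P n"
    then obtain N where N: "\<And>n. n \<ge> N \<Longrightarrow> P n" by auto
    have "P (\<lfloor>x\<rfloor> + 1)" if "x \<ge> of_int N" for x :: real
      using that by (intro N) linarith
    then show "\<exists>N. \<forall>n\<ge>N. P (\<lfloor>n::real\<rfloor> + 1)" by blast
  qed
qed

lemma eventually_floor: "eventually (\<lambda>x::real. P (\<lfloor>x\<rfloor> + 1)) at_top \<longleftrightarrow> eventually P at_top"
  by (subst filtermap_floor[symmetric]) (simp add: eventually_filtermap)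

lemma tendsto_floor:
  fixes f :: "int \<Rightarrow> real"
  shows "((\<lambda>x::real. f (\<lfloor>x\<rfloor> + 1)) \<longlongrightarrow> l) at_top \<longleftrightarrow> (f \<longlongrightarrow> l) at_top"
  unfolding filterlim_def by (subst filtermap_floor[symmetric]) (simp add: filtermap_filtermap)

lemma asymp_equiv_ratio:
  fixes f g :: "real \<Rightarrow> real"
  assumes "eventually (\<lambda>x. g x > 0) at_top"
  shows "f \<sim>[at_top] g \<longleftrightarrow> ((\<lambda>x. f x / g x) \<longlongrightarrow> 1) at_top"
  unfolding asymp_equiv_def
  by (rule filterlim_cong[OF refl refl]) (use assms in eventually_elim, auto)

text \<open>
  A real shift by \<open>y\<close> moves the floor by \<open>\<lfloor>y\<rfloor>\<close> or \<open>\<lfloor>y\<rfloor> + 1\<close>, depending on \<open>x\<close>, so two integer shifts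
  have to be controlled at once.
\<close>
lemma long_tailed_floor:
  fixes f :: "int \<Rightarrow> real"
  assumes f: "\<And>n. f n \<ge> 0"
  shows "long_tailed (\<lambda>x. f (\<lfloor>x\<rfloor> + 1)) \<longleftrightarrow> seq_L f"
proof -
  let ?a = "\<lambda>x::real. f (\<lfloor>x\<rfloor> + 1)"
  have meas: "?a \<in> borel_measurable borel"
    by measurable
  have pos: "(\<exists>x0>0. \<forall>x\<ge>x0. ?a x > 0) \<longleftrightarrow> eventually (\<lambda>n. f n > 0) at_top"
  proof -
    have "(\<exists>x0>0. \<forall>x\<ge>x0. ?a x > 0) \<longleftrightarrow> eventually (\<lambda>x. ?a x > 0) at_top"
      unfolding eventually_at_top_linorder
      by (metis (no_types, opaque_lifting) max.bounded_iff max.strict_coboundedI2 zero_less_one)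
    then show ?thesis using eventually_floor[of "\<lambda>n. f n > 0"] by simp
  qed
  show ?thesis
  proof
    assume L: "long_tailed ?a"
    then have ev: "eventually (\<lambda>n. f n > 0) at_top"
      unfolding long_tailed_def pos by blast
    have "\<forall>y>0. (\<lambda>x. ?a (x + y)) \<sim>[at_top] ?a" using L unfolding long_tailed_def by blast
    from this[rule_format, OF zero_less_one] have "(\<lambda>x. ?a (x + 1)) \<sim>[at_top] ?a" .
    then have "((\<lambda>x. ?a (x + 1) / ?a x) \<longlongrightarrow> 1) at_top"
      using eventually_floor[of "\<lambda>n. f n > 0"] ev by (subst (asm) asymp_equiv_ratio) simp_all
    then have "((\<lambda>n. f (n + 1) / f n) \<longlongrightarrow> 1) at_top"
      using tendsto_floor[of "\<lambda>n. f (n + 1) / f n" 1] by (simp add: add.assoc)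
    with ev show "seq_L f" by (simp add: seq_L_def)
  next
    assume L: "seq_L f"
    then have ev: "eventually (\<lambda>n. f n > 0) at_top" by (simp add: seq_L_def)
    have ratio: "((\<lambda>n. f (n + k) / f n) \<longlongrightarrow> 1) at_top" for k
      by (rule long_tail_ratio) (use L in \<open>auto simp: seq_L_def\<close>)
    have "(\<lambda>x. ?a (x + y)) \<sim>[at_top] ?a" for y :: real
    proof (subst asymp_equiv_ratio)
      show "eventually (\<lambda>x. ?a x > 0) at_top" using eventually_floor[of "\<lambda>n. f n > 0"] ev by simp
      show "((\<lambda>x. ?a (x + y) / ?a x) \<longlongrightarrow> 1) at_top"
      proof (rule tendstoI)
        fix e :: real assume e: "e > 0"
        have "eventually (\<lambda>n. dist (f (n + \<lfloor>y\<rfloor>) / f n) 1 < e \<and> dist (f (n + (\<lfloor>y\<rfloor> + 1)) / f n) 1 < e) at_top"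
          using tendstoD[OF ratio e] by (intro eventually_conj)
        then have "eventually (\<lambda>x::real. dist (f (\<lfloor>x\<rfloor> + 1 + \<lfloor>y\<rfloor>) / ?a x) 1 < e \<and>
            dist (f (\<lfloor>x\<rfloor> + 1 + (\<lfloor>y\<rfloor> + 1)) / ?a x) 1 < e) at_top"
          using eventually_floor[of "\<lambda>n. dist (f (n + \<lfloor>y\<rfloor>) / f n) 1 < e \<and> dist (f (n + (\<lfloor>y\<rfloor> + 1)) / f n) 1 < e"]
          by simp
        then show "eventually (\<lambda>x. dist (?a (x + y) / ?a x) 1 < e) at_top"
        proof eventually_elim
          case (elim x)
          have "\<lfloor>x + y\<rfloor> + 1 = \<lfloor>x\<rfloor> + 1 + \<lfloor>y\<rfloor> \<or> \<lfloor>x + y\<rfloor> + 1 = \<lfloor>x\<rfloor> + 1 + (\<lfloor>y\<rfloor> + 1)"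
            by linarith
          with elim show ?case by (elim disjE conjE) (simp_all only:)
        qed
      qed
    qed
    then show "long_tailed ?a"
      unfolding long_tailed_def pos using meas f ev by auto
  qed
qed

text \<open>
  Small \<open>y > 0\<close> may leave the floor unchanged; this is why the constant is raised to at least \<open>1\<close>
  from right to left.
\<close>
lemma almost_decreasing_floor:
  fixes f :: "int \<Rightarrow> real"
  assumes f: "\<And>n. f n \<ge> 0"
  shows "almost_decreasing (\<lambda>x. f (\<lfloor>x\<rfloor> + 1)) \<longleftrightarrow> seq_D f"
proof
  assume "almost_decreasing (\<lambda>x. f (\<lfloor>x\<rfloor> + 1))"
  then obtain x0 K where x0: "\<And>x y :: real. x > x0 \<Longrightarrow> y > 0 \<Longrightarrow> f (\<lfloor>x + y\<rfloor> + 1) \<le> K * f (\<lfloor>x\<rfloor> + 1)"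
    unfolding almost_decreasing_def by blast
  have "f (n + k) \<le> K * f n" if n: "n \<ge> \<lfloor>x0\<rfloor> + 2" and k: "k > 0" for n k
  proof -
    have "real_of_int (n - 1) > x0" using n by linarith
    then have "f (\<lfloor>real_of_int (n - 1) + of_int k\<rfloor> + 1) \<le> K * f (\<lfloor>real_of_int (n - 1)\<rfloor> + 1)"
      using k by (intro x0) auto
    moreover have "\<lfloor>real_of_int (n - 1) + of_int k\<rfloor> + 1 = n + k" "\<lfloor>real_of_int (n - 1)\<rfloor> + 1 = n"
      by linarith+
    ultimately show ?thesis by simp
  qed
  then show "seq_D f" unfolding seq_D_def eventually_at_top_linorder by blast
next
  assume "seq_D f"
  then obtain K N where K: "\<And>n k. n \<ge> N \<Longrightarrow> k > 0 \<Longrightarrow> f (n + k) \<le> K * f n"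
    by (auto simp: seq_D_def eventually_at_top_linorder)
  have "f (\<lfloor>x + y\<rfloor> + 1) \<le> max K 1 * f (\<lfloor>x\<rfloor> + 1)" if x: "x > max 1 (of_int N)" and y: "y > 0" for x y :: real
  proof -
    define n where "n = \<lfloor>x\<rfloor> + 1"
    define k where "k = \<lfloor>x + y\<rfloor> - \<lfloor>x\<rfloor>"
    have n: "n \<ge> N" using x unfolding n_def by linarith
    have k: "k \<ge> 0" using y floor_mono[of x "x + y"] unfolding k_def by simp
    have "f (n + k) \<le> max K 1 * f n"
    proof (cases "k = 0")
      case True
      then show ?thesis using mult_right_mono[of 1 "max K 1" "f n"] f[of n] by simp
    next
      case False
      then have "f (n + k) \<le> K * f n" using k n by (intro K) auto
      also have "\<dots> \<le> max K 1 * f n" by (intro mult_right_mono f) auto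
      finally show ?thesis .
    qed
    then show ?thesis by (simp add: n_def k_def add.commute)
  qed
  moreover have "max 1 (real_of_int N) > 0" "max K 1 > 0" by auto
  ultimately show "almost_decreasing (\<lambda>x. f (\<lfloor>x\<rfloor> + 1))"
    unfolding almost_decreasing_def using f by blast
qed

lemma
  assumes F: "lattice_dist F" and G: "lattice_dist G"
  shows lattice_dist_convolution: "lattice_dist (F \<star> G)"
    and mass_convolution: "mass (F \<star> G) = conv (mass F) (mass G)"
proof -
  interpret F: real_distribution F using F by (simp add: lattice_dist_def)
  interpret G: real_distribution G using G by (simp add: lattice_dist_def)
  have FZ: "AE x in F. x \<in> \<int>" and GZ: "AE x in G. x \<in> \<int>"
    using F G by (auto simp: lattice_dist_def)
  have RF: "real_distribution F" "real_distribution G" using F G by (auto simp: lattice_dist_def)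
  have em: "emeasure (F \<star> G) A = (\<integral>\<^sup>+x. emeasure G {a. a + x \<in> A} \<partial>F)" if "A \<in> sets borel" for A
    by (rule convolution_emeasure[OF that]) (auto simp: F.finite_measure_axioms G.finite_measure_axioms)
  have "emeasure (F \<star> G) UNIV = 1"
    using G.emeasure_space_1 F.emeasure_space_1 by (subst em) auto
  then have P: "prob_space (F \<star> G)"
    by (intro prob_spaceI) (simp add: space_convolution)
  then interpret C: prob_space "F \<star> G" .
  have RC: "real_distribution (F \<star> G)"
    unfolding real_distribution_def real_distribution_axioms_def
    using P by (simp add: sets_convolution space_convolution)
  have Zb: "(\<int> :: real set) \<in> sets borel"
    by (rule borel_closed) (rule closed_Ints)
  have GZ1: "emeasure G {a. a + x \<in> \<int>} = 1" if "x \<in> \<int>" for x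
  proof -
    have "{a. a + x \<in> \<int>} = \<int>" using that by (auto dest: Ints_diff[OF _ that])
    moreover have "emeasure G \<int> = 1"
    proof -
      have "G.prob \<int> = 1" by (subst G.prob_eq_1) (use GZ Zb in auto)
      then show ?thesis by (simp add: G.emeasure_eq_measure)
    qed
    ultimately show ?thesis by simp
  qed
  have "emeasure (F \<star> G) \<int> = (\<integral>\<^sup>+x. 1 \<partial>F)"
    unfolding em[OF Zb] by (rule nn_integral_cong_AE) (use FZ in eventually_elim, rule GZ1)
  then have "C.prob \<int> = 1"
    using F.emeasure_space_1 by (simp add: measure_def)
  then have "AE x in F \<star> G. x \<in> \<int>"
    by (rule C.AE_prob_1)
  with RC show "lattice_dist (F \<star> G)" by (simp add: lattice_dist_def)
  show "mass (F \<star> G) = conv (mass F) (mass G)"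
  proof
    fix n :: int
    have "emeasure (F \<star> G) {of_int n} = (\<integral>\<^sup>+x. ennreal (mass G (n - \<lfloor>x\<rfloor>)) \<partial>F)"
    proof (subst em)
      show "(\<integral>\<^sup>+x. emeasure G {a. a + x \<in> {real_of_int n}} \<partial>F) = (\<integral>\<^sup>+x. ennreal (mass G (n - \<lfloor>x\<rfloor>)) \<partial>F)"
      proof (rule nn_integral_cong_AE, use FZ in eventually_elim)
        fix x :: real assume "x \<in> \<int>"
        then obtain k where k: "x = of_int k" by (auto elim: Ints_cases)
        have "{a. a + x \<in> {real_of_int n}} = {of_int (n - k)}" by (auto simp: k)
        then show "emeasure G {a. a + x \<in> {real_of_int n}} = ennreal (mass G (n - \<lfloor>x\<rfloor>))"
          by (simp add: k mass_def G.emeasure_eq_measure)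
      qed
    qed simp
    also have "\<dots> = (\<integral>\<^sup>+j. ennreal (mass G (n - j)) \<partial>distr F (count_space UNIV) floor)"
      by (rule nn_integral_distr[symmetric]) auto
    also have "\<dots> = (\<integral>\<^sup>+j. ennreal (mass F j * mass G (n - j)) \<partial>count_space UNIV)"
      unfolding lattice_distr_mass[OF RF(1) FZ]
      by (subst nn_integral_density) (auto simp: ennreal_mult)
    also have "\<dots> = ennreal (conv (mass F) (mass G) n)"
    proof -
      have s: "(\<lambda>j. mass F j * mass G (n - j)) summable_on UNIV"
        by (rule conv_summable) (use ell1_mass RF FZ GZ in auto)
      then have s': "Infinite_Set_Sum.abs_summable_on (\<lambda>j. mass F j * mass G (n - j)) UNIV"
        using abs_summable_equivalent[of "\<lambda>j. mass F j * mass G (n - j)" UNIV] by (simp add: abs_mult)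
      show ?thesis
        using nn_integral_conv_infsetsum[OF s'] infsetsum_infsum[OF s'] by (simp add: conv_def)
    qed
    finally show "mass (F \<star> G) n = conv (mass F) (mass G) n"
      by (simp add: mass_def measure_def conv_def infsum_nonneg)
  qed
qed

lemma lattice_dist_return: "lattice_dist (return borel 0)" and mass_return: "mass (return borel 0) = unit_seq"
proof -
  have "prob_space (return borel (0::real))" by (rule prob_space_return) simp
  moreover have "AE x in return borel (0::real). x \<in> \<int>"
  proof (rule AE_I[of _ _ "- \<int>"])
    have Zb: "- (\<int> :: real set) \<in> sets borel"
      by (intro borel_comp borel_closed closed_Ints)
    then show "- \<int> \<in> sets (return borel (0::real))" by simp
    show "emeasure (return borel 0) (- (\<int> :: real set)) = 0"
      using Zb by (simp add: emeasure_return)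
  qed auto
  ultimately show "lattice_dist (return borel 0)"
    unfolding lattice_dist_def real_distribution_def real_distribution_axioms_def by simp
  show "mass (return borel 0) = unit_seq"
    by (auto simp: mass_def unit_seq_def measure_return indicator_def)
qed

lemma
  assumes F: "lattice_dist F"
  shows L_Delta_iff: "F \<in> L_Delta 1 \<longleftrightarrow> seq_L (mass F)"
    and S_Delta_iff: "F \<in> S_Delta 1 \<longleftrightarrow> seq_S (mass F)"
    and D_Delta_iff: "F \<in> D_Delta 1 \<longleftrightarrow> seq_D (mass F)"
proof -
  have R: "real_distribution F" using F by (simp add: lattice_dist_def)
  have lp: "local_prob 1 F = (\<lambda>x. mass F (\<lfloor>x\<rfloor> + 1))"
    by (simp add: fun_eq_iff local_prob_lattice[OF F])
  show L: "F \<in> L_Delta 1 \<longleftrightarrow> seq_L (mass F)"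
    using R by (simp add: L_Delta_def lp long_tailed_floor)
  show "F \<in> D_Delta 1 \<longleftrightarrow> seq_D (mass F)"
    using R by (simp add: D_Delta_def lp almost_decreasing_floor)
  have F1: "lattice_dist (F \<star> return borel 0)"
    by (rule lattice_dist_convolution[OF F lattice_dist_return])
  have F2: "lattice_dist (conv_power F 2)" "mass (conv_power F 2) = conv (mass F) (mass F)"
    using lattice_dist_convolution[OF F F1] mass_convolution[OF F F1]
      mass_convolution[OF F lattice_dist_return]
    by (simp_all add: numeral_2_eq_2 mass_return conv_unit)
  have lp2: "local_prob 1 (conv_power F 2) = (\<lambda>x. conv (mass F) (mass F) (\<lfloor>x\<rfloor> + 1))"
    by (simp add: fun_eq_iff local_prob_lattice[OF F2(1)] F2(2))
  have "local_prob 1 (conv_power F 2) \<sim>[at_top] (\<lambda>x. 2 * local_prob 1 F x) \<longleftrightarrow>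
      ((\<lambda>n. conv (mass F) (mass F) n / mass F n) \<longlongrightarrow> 2) at_top" if "seq_L (mass F)"
  proof -
    have "local_prob 1 (conv_power F 2) \<sim>[at_top] (\<lambda>x. 2 * local_prob 1 F x) \<longleftrightarrow>
      ((\<lambda>x. conv (mass F) (mass F) (\<lfloor>x\<rfloor> + 1) / (2 * mass F (\<lfloor>x\<rfloor> + 1))) \<longlongrightarrow> 1) (at_top :: real filter)"
      unfolding lp lp2
      by (rule asymp_equiv_ratio) (use that eventually_floor[of "\<lambda>n. mass F n > 0"] in \<open>simp add: seq_L_def\<close>)
    also have "\<dots> \<longleftrightarrow> ((\<lambda>n. conv (mass F) (mass F) n / (2 * mass F n)) \<longlongrightarrow> 1) at_top"
      by (rule tendsto_floor[of "\<lambda>n. conv (mass F) (mass F) n / (2 * mass F n)"])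
    also have "\<dots> \<longleftrightarrow> ((\<lambda>n. conv (mass F) (mass F) n / mass F n) \<longlongrightarrow> 2) at_top"
      using tendsto_mult_left_iff[of 2 "\<lambda>n. conv (mass F) (mass F) n / (2 * mass F n)" 1 at_top]
      by simp
    finally show ?thesis .
  qed
  then show "F \<in> S_Delta 1 \<longleftrightarrow> seq_S (mass F)"
    by (auto simp: S_Delta_def L seq_S_def)
qed

lemma local_prob_ratio_iff:
  assumes "lattice_dist F" "lattice_dist G"
  shows "((\<lambda>x. local_prob 1 F x / local_prob 1 G x) \<longlongrightarrow> a) at_top \<longleftrightarrow>
    ((\<lambda>n. mass F n / mass G n) \<longlongrightarrow> a) at_top"
  using tendsto_floor[of "\<lambda>n. mass F n / mass G n" a] assms by (simp add: local_prob_lattice)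

section \<open>Infinitely divisible lattice distributions with finite Levy measure\<close>
lemma integral_scale_measure:
  fixes h :: "'a \<Rightarrow> 'b::{banach,second_countable_topology}"
  assumes "h \<in> borel_measurable M" "r \<ge> 0"
  shows "integral\<^sup>L (scale_measure (ennreal r) M) h = r *\<^sub>R integral\<^sup>L M h"
proof -
  have "scale_measure (ennreal r) M = density M (\<lambda>_. ennreal r)"
    by (rule measure_eqI) (auto simp: emeasure_density nn_integral_cmult)
  then show ?thesis
    using assms by (simp add: integral_density)
qed

definition levy_kernel :: "real \<Rightarrow> real \<Rightarrow> complex" where
  "levy_kernel z y = iexp (z * y) - 1 - \<i> * of_real (z * y * indicator {y. \<bar>y\<bar> \<le> 1} y)"

lemma levy_kernel_measurable [measurable]: "levy_kernel z \<in> borel_measurable borel"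
  unfolding levy_kernel_def by measurable

lemma (in real_distribution)
  shows integrable_levy_kernel: "integrable M (levy_kernel z)"
    and integral_levy_kernel: "integral\<^sup>L M (levy_kernel z) =
      char M z - 1 - \<i> * of_real (z * (LINT y|M. y * indicator {y. \<bar>y\<bar> \<le> 1} y))"
proof -
  have m: "(\<lambda>y::real. y * indicator {y. \<bar>y\<bar> \<le> 1} y) \<in> borel_measurable M"
    by measurable
  have T: "integrable M (\<lambda>y. y * indicator {y. \<bar>y\<bar> \<le> 1} y)"
    by (rule integrable_const_bound[where B = 1, OF _ m]) (auto simp: indicator_def)
  then have T': "integrable M (\<lambda>y. \<i> * complex_of_real (z * y * indicator {y. \<bar>y\<bar> \<le> 1} y))"
    using integrable_mult_right[OF integrable_of_real[OF T], of "\<i> * of_real z"]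
    by (simp add: mult_ac)
  have E: "integrable M (\<lambda>y. iexp (z * y))"
    using integrable_iexp[of "\<lambda>y. z * y"] by simp
  have C: "integrable M (\<lambda>_. 1 :: complex)" by simp
  show "integrable M (levy_kernel z)"
    unfolding levy_kernel_def using E T' by (intro Bochner_Integration.integrable_diff) auto
  have "levy_kernel z = (\<lambda>y. iexp (z * y) - 1 - \<i> * complex_of_real (z * y * indicator {y. \<bar>y\<bar> \<le> 1} y))"
    by (rule ext) (rule levy_kernel_def)
  then have "integral\<^sup>L M (levy_kernel z) = (CLINT y|M. iexp (z * y)) - (CLINT y|M. 1)
      - (CLINT y|M. \<i> * complex_of_real (z * y * indicator {y. \<bar>y\<bar> \<le> 1} y))"
    by (simp only: Bochner_Integration.integral_diff[OF E C]
        Bochner_Integration.integral_diff[OF Bochner_Integration.integrable_diff[OF E C] T'])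
  also have "(CLINT y|M. \<i> * complex_of_real (z * y * indicator {y. \<bar>y\<bar> \<le> 1} y)) =
      \<i> * of_real (z * (LINT y|M. y * indicator {y. \<bar>y\<bar> \<le> 1} y))"
    by (simp only: integral_mult_right_zero integral_complex_of_real mult.assoc)
  finally show "integral\<^sup>L M (levy_kernel z) =
      char M z - 1 - \<i> * of_real (z * (LINT y|M. y * indicator {y. \<bar>y\<bar> \<le> 1} y))"
    using prob_space by (simp add: char_def)
qed

lemma char_lattice_2pi:
  assumes "lattice_dist F"
  shows "char F (2 * pi) = 1"
proof -
  have "char F (2 * pi) = fourier (mass F) (2 * pi)"
    using assms by (simp add: lattice_dist_def lattice_char)
  also have "\<dots> = fourier (mass F) 0"
    by (simp add: fourier_def)
  also have "\<dots> = 1"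
    using prob_seqD[OF prob_seq_mass[OF assms]] by (simp add: fourier_0)
  finally show ?thesis .
qed

lemma cos_2pi_eq_1: "cos (2 * pi * y) = 1 \<longleftrightarrow> y \<in> \<int>"
  by (auto simp: cos_one_2pi_int Ints_def mult.commute)

text \<open>
  The real part of the exponent at \<open>2 * pi\<close> is a sum of two non-positive terms, the integral of
  \<open>cos (2 * pi * y) - 1\<close> and the Gaussian term, and it vanishes. So both vanish, and the former confines
  \<open>G\<close> to the integers. With the compensator absorbed into the drift \<open>d\<close>, the remaining condition at
  \<open>2 * pi\<close> says that \<open>d\<close> is an integer.
\<close>
lemma lattice_compound_poisson:
  assumes mu: "lattice_dist \<mu>" and G: "real_distribution G" and lam: "lam > 0"
    and levy: "has_levy_measure \<mu> (scale_measure (ennreal lam) G)"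
  obtains m where "lattice_dist G" "mass \<mu> = (\<lambda>n. compound_poisson lam (mass G) (n - m))"
proof -
  interpret G: real_distribution G by fact
  obtain a b where b: "b \<ge> 0" and lk: "\<And>z. char \<mu> z = exp (
        (CLINT y|scale_measure (ennreal lam) G. levy_kernel z y)
        + \<i> * of_real (a * z) - of_real (b\<^sup>2 * z\<^sup>2 / 2))"
    using levy unfolding has_levy_measure_def levy_khintchine_def levy_kernel_def by blast
  have scale: "(CLINT y|scale_measure (ennreal lam) G. levy_kernel z y) = of_real lam * integral\<^sup>L G (levy_kernel z)" for z
    using integral_scale_measure[of "levy_kernel z" G lam] lam by (simp add: scaleR_conv_of_real)
  define c where "c = 2 * pi"
  have Re_int: "Re (integral\<^sup>L G (levy_kernel c)) = (LINT y|G. cos (c * y) - 1)"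
    using integral_Re[OF G.integrable_levy_kernel[of c]] by (simp add: levy_kernel_def Re_exp)
  have int_cos: "integrable G (\<lambda>y. 1 - cos (c * y))"
    by (rule G.integrable_const_bound[where B = 2]) (auto intro: order_trans[OF abs_triangle_ineq4] simp: abs_le_iff)
  have "norm (char \<mu> c) = 1" using char_lattice_2pi[OF mu] by (simp add: c_def)
  then have "lam * (LINT y|G. cos (c * y) - 1) - b\<^sup>2 * c\<^sup>2 / 2 = 0"
    unfolding lk scale norm_exp_eq_Re by (simp add: Re_int)
  moreover have "(LINT y|G. cos (c * y) - 1) = - (LINT y|G. 1 - cos (c * y))"
    by (subst integral_minus[symmetric]) simp
  ultimately have sum0: "lam * (LINT y|G. 1 - cos (c * y)) + b\<^sup>2 * c\<^sup>2 / 2 = 0"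
    by simp
  have nn: "(LINT y|G. 1 - cos (c * y)) \<ge> 0"
    by (rule integral_nonneg_AE) simp
  have "lam * (LINT y|G. 1 - cos (c * y)) \<ge> 0" "b\<^sup>2 * c\<^sup>2 / 2 \<ge> 0"
    using nn lam by auto
  with sum0 have "lam * (LINT y|G. 1 - cos (c * y)) = 0" "b\<^sup>2 * c\<^sup>2 / 2 = 0" by linarith+
  then have zero: "(LINT y|G. 1 - cos (c * y)) = 0" and b0: "b = 0"
    using lam by (auto simp: c_def)
  have "AE y in G. 1 - cos (c * y) = 0"
    using zero by (subst (asm) integral_nonneg_eq_0_iff_AE[OF int_cos]) auto
  then have "AE y in G. y \<in> \<int>"
    by eventually_elim (simp add: c_def flip: cos_2pi_eq_1)
  with G have LG: "lattice_dist G" by (simp add: lattice_dist_def)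
  define d where "d = a - lam * (LINT y|G. y * indicator {y. \<bar>y\<bar> \<le> 1} y)"
  have ch: "char \<mu> z = exp (of_real lam * (char G z - 1)) * cis (d * z)" for z
    unfolding lk scale G.integral_levy_kernel b0 cis_conv_exp exp_add[symmetric]
    by (rule arg_cong[where f = exp]) (simp add: d_def algebra_simps)
  have "cis (d * c) = 1"
    using ch[of c] char_lattice_2pi[OF mu] char_lattice_2pi[OF LG] by (simp add: c_def)
  then have "cos (2 * pi * d) = 1" by (simp add: c_def complex_eq_iff mult.commute)
  then obtain m where m: "d = of_int m" unfolding cos_2pi_eq_1 by (auto elim: Ints_cases)
  have "mass \<mu> = (\<lambda>n. compound_poisson lam (mass G) (n - m))"
  proof (rule fourier_inject)
    have p: "prob_seq (compound_poisson lam (mass G))"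
      using prob_seq_compound_poisson[OF prob_seq_mass[OF LG]] lam by simp
    have bij: "bij_betw (\<lambda>j. j - m) UNIV (UNIV :: int set)"
      by (rule bij_betwI[where g = "\<lambda>j. j + m"]) auto
    show "ell1 (\<lambda>n. compound_poisson lam (mass G) (n - m))"
      using summable_on_reindex_bij_betw[OF bij, of "compound_poisson lam (mass G)"] prob_seqD(2)[OF p] by simp
    show "ell1 (mass \<mu>)" by (rule prob_seqD(2)[OF prob_seq_mass[OF mu]])
    fix t
    have "fourier (mass \<mu>) t = char \<mu> t" "fourier (mass G) t = char G t"
      using mu LG by (auto simp: lattice_dist_def lattice_char)
    then show "fourier (mass \<mu>) t = fourier (\<lambda>n. compound_poisson lam (mass G) (n - m)) t"
      by (simp add: fourier_shift fourier_compound_poisson[OF prob_seq_mass[OF LG]] ch m mult.commute)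
  qed
  with LG show ?thesis using that by blast
qed

theorem corollary4p3:
  fixes \<mu> G :: "real measure" and lam :: real
  assumes "infinitely_divisible \<mu>"
    and "AE x in \<mu>. x \<in> \<int>"
    and "lam > 0"
    and "real_distribution G"
    and "has_levy_measure \<mu> (scale_measure (ennreal lam) G)"
  shows "((\<mu> \<in> S_Delta 1 \<inter> D_Delta 1 \<longleftrightarrow> G \<in> S_Delta 1 \<inter> D_Delta 1) \<and>
          (G \<in> S_Delta 1 \<inter> D_Delta 1 \<longleftrightarrow>
             G \<in> L_Delta 1 \<inter> D_Delta 1 \<and>
             ((\<lambda>x. local_prob 1 \<mu> x / local_prob 1 G x) \<longlongrightarrow> lam) at_top)) \<and>
         ((AE x in G. x \<in> \<nat>) \<longrightarrow>
          (\<mu> \<in> S_Delta 1 \<longleftrightarrow> G \<in> S_Delta 1) \<and>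
          (G \<in> S_Delta 1 \<longleftrightarrow>
             G \<in> L_Delta 1 \<and>
             ((\<lambda>x. local_prob 1 \<mu> x / local_prob 1 G x) \<longlongrightarrow> lam) at_top))"
proof -
  have mu: "lattice_dist \<mu>"
    using assms(1,2) by (simp add: lattice_dist_def infinitely_divisible_def)
  obtain m where G: "lattice_dist G" and m: "mass \<mu> = (\<lambda>n. compound_poisson lam (mass G) (n - m))"
    using lattice_compound_poisson[OF mu assms(4,3,5)] .
  let ?g = "mass G" and ?p = "compound_poisson lam (mass G)"
  note iffs = L_Delta_iff[OF G] S_Delta_iff[OF G] D_Delta_iff[OF G] S_Delta_iff[OF mu] D_Delta_iff[OF mu]
  have g: "prob_seq ?g" by (rule prob_seq_mass[OF G])
  have S: "\<mu> \<in> S_Delta 1 \<longleftrightarrow> seq_S ?p" and D: "\<mu> \<in> D_Delta 1 \<longleftrightarrow> seq_D ?p"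
    by (simp_all add: iffs m seq_S_shift_iff seq_D_shift_iff)
  have ratio: "((\<lambda>x. local_prob 1 \<mu> x / local_prob 1 G x) \<longlongrightarrow> lam) at_top \<longleftrightarrow>
      ((\<lambda>n. ?p n / ?g n) \<longlongrightarrow> lam) at_top" if "seq_L ?g"
    unfolding local_prob_ratio_iff[OF mu G] m by (rule shift_ratio_tendsto_iff[OF that])
  have SL: "seq_S ?g \<Longrightarrow> seq_L ?g" by (simp add: seq_S_def)
  have U: "admissible_tail UNIV f \<longleftrightarrow> seq_D f" for f by (auto simp: admissible_tail_def)
  have N: "admissible_tail {0..} f" for f by (simp add: admissible_tail_def)
  have fwd: "seq_S ?p" "admissible_tail I ?p" "((\<lambda>n. ?p n / ?g n) \<longlongrightarrow> lam) at_top"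
    if "seq_S ?g" "admissible_tail I ?g" "\<And>n. n \<notin> I \<Longrightarrow> ?g n = 0" for I
    using compound_poisson_of_seq_S[OF g assms(3) that] by auto
  have bwd: "seq_S ?g" "admissible_tail I ?g"
    if "seq_S ?p" "admissible_tail I ?p" "\<And>n. n \<notin> I \<Longrightarrow> ?g n = 0" for I
    using seq_S_of_compound_poisson[OF g assms(3) that] by auto
  have lim: "seq_S ?g" if "seq_L ?g" "((\<lambda>n. ?p n / ?g n) \<longlongrightarrow> lam) at_top"
    using seq_S_of_compound_poisson_ratio[OF g assms(3) that] .
  have fwd_D: "seq_S ?p \<and> seq_D ?p \<and> ((\<lambda>n. ?p n / ?g n) \<longlongrightarrow> lam) at_top" if "seq_S ?g" "seq_D ?g"
    using fwd[of UNIV] that unfolding U by simp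
  have bwd_D: "seq_S ?g \<and> seq_D ?g" if "seq_S ?p" "seq_D ?p"
    using bwd[of UNIV] that unfolding U by simp
  have first: "seq_S ?p \<and> seq_D ?p \<longleftrightarrow> seq_S ?g \<and> seq_D ?g"
    using fwd_D bwd_D by blast
  have first_ratio: "seq_S ?g \<and> seq_D ?g \<longleftrightarrow> (seq_L ?g \<and> seq_D ?g) \<and>
      ((\<lambda>x. local_prob 1 \<mu> x / local_prob 1 G x) \<longlongrightarrow> lam) at_top"
    using fwd_D lim ratio SL by metis
  have second: "(seq_S ?p \<longleftrightarrow> seq_S ?g) \<and> (seq_S ?g \<longleftrightarrow> seq_L ?g \<and>
      ((\<lambda>x. local_prob 1 \<mu> x / local_prob 1 G x) \<longlongrightarrow> lam) at_top)"
    if AE: "AE x in G. x \<in> \<nat>"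
  proof -
    interpret G: real_distribution G by fact
    have zero: "?g n = 0" if "n \<notin> {0..}" for n
    proof -
      have "measure G {of_int n} = measure G {}"
      proof (rule measure_eq_AE)
        show "AE x in G. x \<in> {real_of_int n} \<longleftrightarrow> x \<in> {}"
          using AE by eventually_elim (use that in \<open>auto elim!: Nats_cases\<close>)
      qed auto
      then show ?thesis by (simp add: mass_def)
    qed
    have "seq_S ?p \<and> ((\<lambda>n. ?p n / ?g n) \<longlongrightarrow> lam) at_top" if "seq_S ?g"
      using fwd[OF that N zero] by simp
    moreover have "seq_S ?g" if "seq_S ?p"
      using bwd[OF that N zero] by simp
    ultimately show ?thesis
      using lim ratio SL by metis
  qed
  show ?thesis
    using first first_ratio second by (simp only: Int_iff S D iffs(1-3)) blast
qed

end
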